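(* Let $r\ge1$ be an integer, $1\le p<\infty$ and $K>0$. Let $\Lambda=\{\lambda_n\}_{n\in\mathbb Z}\subset\mathbb R$ be a strictly increasing sequence with $\lambda_{n+1}-\lambda_n\le K$ for all $n\in\mathbb Z$, let $I=\bigcup_{n\in\mathbb Z}[\lambda_n,\lambda_{n+1}]$, and assume that the length of $I$ satisfies $|I|\ge(4r+2)K$ (with $|I|=\infty$ allowed). (a) Assume that there are constants $A,B\in(0,\infty)$ such that $$A\,\|f\|_{\mathrm{eq},L}\le\|f\|_{L_p^r(I)|_\Lambda}\le B\,\|f\|_{\mathrm{eq},L}\qquad\text{for all } f\in L_p^r(I)|_\Lambda .$$ Then there are constants $C,C'\in(0,\infty)$, depending only on $r$, $K$, $A$ and $B$, such that $$C\,\|f\|_{\mathrm{simp},W}\le\|f\|_{W_p^r(I)|_\Lambda}\le C'\,\|f\|_{\mathrm{simp},W}\qquad\text{for all } f\in W_p^r(I)|_\Lambda .$$ (b) If $T:L_p^r(I)|_\Lambda\to L_p^r(I)$ is a quasi-optimal interpolator, then $T$ (restricted to $W_p^r(I)|_\Lambda\subset L_p^r(I)|_\Lambda$) is also a quasi-optimal interpolator $T:W_p^r(I)|_\Lambda\to W_p^r(I)$.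
   Context: Sobolev spaces. For an interval $I\subset\mathbb R$ (possibly infinite), an integer $r\ge1$ and $1\le p<\infty$, $W_p^r(I)$ is the completion of the space of complex functions $F\in\mathcal C^\infty(I)$ for which $\|F\|_{W_p^r(I)}^p=\int_I|F(x)|^p\,dx+\int_I|F^{(r)}(x)|^p\,dx$ is finite. $L_p^r(I)$ is the space of complex functions on $I$ with finite seminorm $\|F\|_{L_p^r(I)}^p=\int_I|F^{(r)}(x)|^p\,dx$. Elements of both spaces are identified with functions $F$ such that $F,\dots,F^{(r-1)}$ are continuous and $F^{(r-1)}$ is (locally) absolutely continuous. Trace spaces. For $\mathbb X=W_p^r(I)$ or $L_p^r(I)$ and $\Lambda\subset I$, $\mathbb X|_\Lambda=\{F|_\Lambda: F\in\mathbb X\}$, with the norm (or seminorm) $\|f\|_{\mathbb X|_\Lambda}=\inf\{\|F\|_{\mathbb X}: F\in\mathbb X,\ F|_\Lambda=f\}$. A quasi-optimal interpolator $T:\mathbb X|_\Lambda\to\mathbb X$ is a linear operator that is bounded for these (semi)norms and satisfies $(Tf)|_\Lambda=f$ for all $f\in\mathbb X|_\Lambda$. Divided differences. $f(x_1)$ is the value at $x_1$, $f(x_1,x_2)=\frac{f(x_2)-f(x_1)}{x_2-x_1}$, and $f(x_1,\dots,x_n)=\frac{f(x_2,\dots,x_n)-f(x_1,\dots,x_{n-1})}{x_n-x_1}$ for $n\ge3$. For $f:\Lambda\to\mathbb C$, $$\|f\|_{\mathrm{eq},L}^p=\sum_{n\in\mathbb Z}(\lambda_{n+r}-\lambda_n)|f(\lambda_n,\dots,\lambda_{n+r})|^p,$$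 $$\|f\|_{\mathrm{simp},W}^p=\|f\|_{\mathrm{eq},L}^p+\sum_{n\in\mathbb Z}(\lambda_{n+1}-\lambda_{n-1})|f(\lambda_n)|^p.$$ *)

theory Defs
  imports "HOL-Analysis.Analysis"
begin

text \<open>
  All (semi)norms take values in \<^typ>\<open>ennreal\<close>, so that a quantity such as
  \<open>eqL_norm\<close> below may be infinite.
\<close>

definition ennreal_root :: "real \<Rightarrow> ennreal \<Rightarrow> ennreal" where
  "ennreal_root p x = (if x = \<infinity> then \<infinity> else ennreal (enn2real x powr (1 / p)))"

text \<open>
  A finite family of non-overlapping compact intervals contained in \<open>S\<close> is a set \<open>D\<close> that is
  a \<open>division_of\<close> its own union, with \<open>\<Union>D \<subseteq> S\<close>.
\<close>

definition absolutely_continuous_on :: "real set \<Rightarrow> (real \<Rightarrow> complex) \<Rightarrow> bool" where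
  "absolutely_continuous_on S f \<longleftrightarrow>
     (\<forall>\<epsilon>>0. \<exists>\<delta>>0. \<forall>D. D division_of \<Union>D \<and> \<Union>D \<subseteq> S \<and> (\<Sum>J\<in>D. measure lborel J) < \<delta>
        \<longrightarrow> (\<Sum>J\<in>D. cmod (f (Sup J) - f (Inf J))) < \<epsilon>)"

definition locally_absolutely_continuous_on :: "real set \<Rightarrow> (real \<Rightarrow> complex) \<Rightarrow> bool" where
  "locally_absolutely_continuous_on I f \<longleftrightarrow>
     (\<forall>a b. {a..b} \<subseteq> I \<longrightarrow> absolutely_continuous_on {a..b} f)"

text \<open>
  The \<open>k\<close>-th derivative of a function on the interval \<open>I\<close>. At points where the derivative does
  not exist, \<open>vector_derivative\<close> returns a fixed default value; for a locally absolutely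
  continuous function these points form a null set.
\<close>

fun nth_derivative :: "real set \<Rightarrow> nat \<Rightarrow> (real \<Rightarrow> complex) \<Rightarrow> real \<Rightarrow> complex" where
  "nth_derivative I 0 F = F"
| "nth_derivative I (Suc k) F =
     (\<lambda>x. vector_derivative (nth_derivative I k F) (at x within I))"

text \<open>
  A function on a set \<open>S\<close> of reals is represented by its extension by zero to the whole line.
  This makes representatives unique, and spaces of functions on \<open>S\<close> become linear subspaces of
  \<^typ>\<open>real \<Rightarrow> complex\<close> under the pointwise operations.
\<close>

definition vanishes_outside :: "real set \<Rightarrow> (real \<Rightarrow> complex) \<Rightarrow> bool" where
  "vanishes_outside S f \<longleftrightarrow> (\<forall>x. x \<notin> S \<longrightarrow> f x = 0)"

definition restriction :: "(real \<Rightarrow> complex) \<Rightarrow> real set \<Rightarrow> real \<Rightarrow> complex" where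
  "restriction F S = (\<lambda>x. if x \<in> S then F x else 0)"

text \<open>For \<open>r \<ge> 1\<close>: \<open>F, \<dots>, F^(r-1)\<close> exist and are continuous on \<open>I\<close>, the last one being
  locally absolutely continuous.\<close>

definition sobolev_regular :: "nat \<Rightarrow> real set \<Rightarrow> (real \<Rightarrow> complex) \<Rightarrow> bool" where
  "sobolev_regular r I F \<longleftrightarrow>
     (\<forall>k<r - 1. \<forall>x\<in>I. nth_derivative I k F differentiable (at x within I)) \<and>
     (\<forall>k<r. continuous_on I (nth_derivative I k F)) \<and>
     locally_absolutely_continuous_on I (nth_derivative I (r - 1) F)"

definition Lp_power :: "real \<Rightarrow> real set \<Rightarrow> (real \<Rightarrow> complex) \<Rightarrow> ennreal" where
  "Lp_power p I F = (\<integral>\<^sup>+x\<in>I. ennreal (cmod (F x) powr p) \<partial>lebesgue)"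

definition L_norm :: "real \<Rightarrow> nat \<Rightarrow> real set \<Rightarrow> (real \<Rightarrow> complex) \<Rightarrow> ennreal" where
  "L_norm p r I F = ennreal_root p (Lp_power p I (nth_derivative I r F))"

definition W_norm :: "real \<Rightarrow> nat \<Rightarrow> real set \<Rightarrow> (real \<Rightarrow> complex) \<Rightarrow> ennreal" where
  "W_norm p r I F = ennreal_root p (Lp_power p I F + Lp_power p I (nth_derivative I r F))"

definition L_space :: "real \<Rightarrow> nat \<Rightarrow> real set \<Rightarrow> (real \<Rightarrow> complex) set" where
  "L_space p r I = {F. vanishes_outside I F \<and> sobolev_regular r I F \<and> L_norm p r I F < \<infinity>}"

text \<open>The completion of the smooth functions of finite norm, through its identification with a
  space of functions.\<close>

definition W_space :: "real \<Rightarrow> nat \<Rightarrow> real set \<Rightarrow> (real \<Rightarrow> complex) set" where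
  "W_space p r I = {F. vanishes_outside I F \<and> sobolev_regular r I F \<and> W_norm p r I F < \<infinity>}"

definition trace_space :: "(real \<Rightarrow> complex) set \<Rightarrow> real set \<Rightarrow> (real \<Rightarrow> complex) set" where
  "trace_space X \<Lambda> = (\<lambda>F. restriction F \<Lambda>) ` X"

definition trace_norm ::
    "(real \<Rightarrow> complex) set \<Rightarrow> ((real \<Rightarrow> complex) \<Rightarrow> ennreal) \<Rightarrow> real set \<Rightarrow> (real \<Rightarrow> complex) \<Rightarrow> ennreal"
  where "trace_norm X N \<Lambda> f = (INF F\<in>{F\<in>X. restriction F \<Lambda> = f}. N F)"

text \<open>Only the values of \<open>T\<close> on the trace space matter.\<close>

definition quasi_optimal_interpolator ::
    "(real \<Rightarrow> complex) set \<Rightarrow> ((real \<Rightarrow> complex) \<Rightarrow> ennreal) \<Rightarrow> real set \<Rightarrow>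
     ((real \<Rightarrow> complex) \<Rightarrow> real \<Rightarrow> complex) \<Rightarrow> bool"
  where "quasi_optimal_interpolator X N \<Lambda> T \<longleftrightarrow>
     (\<forall>f\<in>trace_space X \<Lambda>. T f \<in> X) \<and>
     (\<forall>f\<in>trace_space X \<Lambda>. \<forall>g\<in>trace_space X \<Lambda>. T (\<lambda>x. f x + g x) = (\<lambda>x. T f x + T g x)) \<and>
     (\<forall>c. \<forall>f\<in>trace_space X \<Lambda>. T (\<lambda>x. c * f x) = (\<lambda>x. c * T f x)) \<and>
     (\<exists>M::real. \<forall>f\<in>trace_space X \<Lambda>. N (T f) \<le> ennreal M * trace_norm X N \<Lambda> f) \<and>
     (\<forall>f\<in>trace_space X \<Lambda>. restriction (T f) \<Lambda> = f)"

text \<open>\<open>divided_difference f [x\<^sub>1, \<dots>, x\<^sub>n]\<close> is \<open>f(x\<^sub>1, \<dots>, x\<^sub>n)\<close>; the value at the empty list is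
  irrelevant.\<close>

fun divided_difference :: "(real \<Rightarrow> complex) \<Rightarrow> real list \<Rightarrow> complex" where
  "divided_difference f [] = 0"
| "divided_difference f [x] = f x"
| "divided_difference f (x # y # zs) =
     (divided_difference f (y # zs) - divided_difference f (butlast (x # y # zs)))
       / of_real (last (y # zs) - x)"

definition eqL_power :: "real \<Rightarrow> nat \<Rightarrow> (int \<Rightarrow> real) \<Rightarrow> (real \<Rightarrow> complex) \<Rightarrow> ennreal" where
  "eqL_power p r l f = (\<Sum>\<^sub>\<infinity>n\<in>UNIV. ennreal ((l (n + int r) - l n)
      * cmod (divided_difference f (map l [n..n + int r])) powr p))"

definition eqL_norm :: "real \<Rightarrow> nat \<Rightarrow> (int \<Rightarrow> real) \<Rightarrow> (real \<Rightarrow> complex) \<Rightarrow> ennreal" where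
  "eqL_norm p r l f = ennreal_root p (eqL_power p r l f)"

definition simpW_norm :: "real \<Rightarrow> nat \<Rightarrow> (int \<Rightarrow> real) \<Rightarrow> (real \<Rightarrow> complex) \<Rightarrow> ennreal" where
  "simpW_norm p r l f = ennreal_root p (eqL_power p r l f +
      (\<Sum>\<^sub>\<infinity>n\<in>UNIV. ennreal ((l (n + 1) - l (n - 1)) * cmod (f (l n)) powr p)))"

definition covered_interval :: "(int \<Rightarrow> real) \<Rightarrow> real set" where
  "covered_interval l = (\<Union>n. {l n..l (n + 1)})"

definition admissible_sequence :: "nat \<Rightarrow> real \<Rightarrow> (int \<Rightarrow> real) \<Rightarrow> bool" where
  "admissible_sequence r K l \<longleftrightarrow>
     strict_mono l \<and> (\<forall>n. l (n + 1) - l n \<le> K) \<and>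
     emeasure lborel (covered_interval l) \<ge> ennreal ((4 * real r + 2) * K)"

end

theory Submission
  imports Defs
begin

text \<open>
  Write \<open>w\<^sub>n = \<lambda>\<^sub>n\<^sub>+\<^sub>1 - \<lambda>\<^sub>n\<^sub>-\<^sub>1\<close>. Both parts follow from two inequalities, valid for all Sobolev
  functions \<open>F\<close> on \<open>I\<close> with a constant \<open>E\<close> depending only on \<open>r\<close> and \<open>K\<close>:
  the quantity \<open>\<integral> |F|\<^sup>p\<close> is at most \<open>E\<^sup>p (\<Sum> w\<^sub>n |F(\<lambda>\<^sub>n)|\<^sup>p + \<integral> |F\<^sup>(\<^sup>r\<^sup>)|\<^sup>p)\<close>, and
  \<open>\<Sum> w\<^sub>n |F(\<lambda>\<^sub>n)|\<^sup>p\<close> is at most \<open>E\<^sup>p (\<integral> |F|\<^sup>p + \<integral> |F\<^sup>(\<^sup>r\<^sup>)|\<^sup>p)\<close>. In particular any extension in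
  \<open>L\<^sub>p\<^sup>r\<close> of a trace of \<open>W\<^sub>p\<^sup>r\<close> is automatically in \<open>W\<^sub>p\<^sup>r\<close>, with control of the norm.
  The inequalities are additive over pieces of \<open>I\<close> of length between \<open>2rK\<close> and \<open>4rK\<close>. Such a piece
  contains \<open>r\<close> intervals of length \<open>K\<close> with gaps \<open>K\<close>; choosing in each of them a point where \<open>|F|\<close> is
  small (a node, respectively any point) and interpolating, \<open>sup |F|\<close> over the piece is bounded by
  these \<open>r\<close> values and \<open>\<integral> |F\<^sup>(\<^sup>r\<^sup>)|\<close>. The last step uses that an absolutely continuous function is
  differentiable almost everywhere and is the integral of its derivative.
\<close>

subsection \<open>Almost everywhere differentiability of absolutely continuous functions\<close>

text \<open>Nothing bounds the gaps between nodes from below, so interpolation at consecutive nodes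
  would have uncontrolled constants. What survives clustering is weight: the \<open>w_n\<close> of
  the nodes in any window \<open>{u<..u + K}\<close> inside \<open>I\<close> add up to at least
  \<open>K\<close>, so at one of these nodes \<open>K * |F|^p\<close> is at most the node sum of the
  window. One such node per window, with gaps \<open>K\<close> between windows, gives
  \<open>K\<close>-separated samples, and the interpolation constants depend on \<open>r\<close> and
  \<open>K\<close> only. The minimum of \<open>|F|\<close> over a window does the same for the
  integral, so both inequalities rest on one local estimate. The node sum depends on the trace
  alone. All extensions of \<open>f\<close> share it, and this turns a bound for
  \<open>F^(r)\<close> into a bound for the full norm: for near-optimal extensions in (a), for
  \<open>T f\<close> in (b). In (a) the constants are chosen before \<open>p\<close>, so
  inequalities between p-th powers carry a factor \<open>c powr p\<close> with \<open>c\<close> free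
  of \<open>p\<close>. The top derivative takes default values where it does not exist, so it says
  nothing about \<open>F\<close> until differentiability almost everywhere and the fundamental
  theorem are available.\<close>

lemma division_of_disjoint_intervals:
  fixes D :: "real set set"
  assumes "finite D" "disjoint D" "\<And>J. J \<in> D \<Longrightarrow> \<exists>u v. u < v \<and> J = {u..v}"
  shows "D division_of \<Union>D"
proof (rule division_ofI)
  fix J assume "J \<in> D"
  then show "J \<noteq> {}" "\<exists>a b. J = cbox a b" "J \<subseteq> \<Union>D" using assms(3)[of J] by auto
next
  fix J J' assume "J \<in> D" "J' \<in> D" "J \<noteq> J'"
  then have "J \<inter> J' = {}" using assms(2) by (auto dest: disjointD)
  then show "interior J \<inter> interior J' = {}"
    by (metis interior_Int interior_empty)
qed (use assms in auto)

lemma measure_division: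
  fixes D :: "real set set"
  assumes "D division_of S"
  shows "S \<in> lmeasurable" "measure lebesgue S = (\<Sum>J\<in>D. measure lborel J)"
proof -
  have cl: "\<exists>a b. J = cbox a b" if "J \<in> D" for J
    using division_ofD(4)[OF assms] that by auto
  have "measure lborel J = measure lebesgue J" if "J \<in> D" for J
    using cl[OF that] by auto
  then show "measure lebesgue S = (\<Sum>J\<in>D. measure lborel J)"
    using content_division[OF assms] by simp
  have "\<Union>D \<in> lmeasurable"
    using division_ofD(1)[OF assms] cl by (intro fmeasurable.finite_Union) auto
  then show "S \<in> lmeasurable" using division_ofD(6)[OF assms] by simp
qed

text \<open>\<open>S\<close> need not be measurable, so its size is recorded through a measurable
  superset \<open>T\<close>. Vitali's theorem, with intervals written as balls, gives countably many
  disjoint intervals covering \<open>S\<close> up to a null set; a finite subfamily keeps all but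
  \<open>e\<close> of their measure.\<close>

lemma Vitali_intervals_finite:
  fixes S U :: "real set" and P :: "real \<Rightarrow> real \<Rightarrow> bool"
  assumes U: "open U" "bounded U" and SU: "S \<subseteq> U" and e: "e > 0"
    and fine: "\<And>x d. x \<in> S \<Longrightarrow> d > 0 \<Longrightarrow> \<exists>u v. u \<le> x \<and> x \<le> v \<and> u < v \<and> v - u < d \<and> P u v"
  obtains D T where "finite D" "disjoint D" "\<And>J. J \<in> D \<Longrightarrow> \<exists>u v. u < v \<and> J = {u..v} \<and> P u v"
    "\<Union>D \<subseteq> U" "T \<in> lmeasurable" "S \<subseteq> T" "measure lebesgue T < sum (measure lborel) D + e"
proof -
  define K where "K = {(u,v). u < v \<and> {u..v} \<subseteq> U \<and> P u v}"
  define ce where "ce = (\<lambda>(u,v). (u + v) / 2 :: real)"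
  define ra where "ra = (\<lambda>(u,v). (v - u) / 2 :: real)"
  define iv where "iv = (\<lambda>(u,v). {u..v :: real})"
  have cb: "cball (ce i) (ra i) = iv i" for i
    by (cases i) (auto simp: ce_def ra_def iv_def cball_eq_atLeastAtMost field_simps)
  have 1: "0 < ra i" if "i \<in> K" for i
    using that by (auto simp: K_def ra_def)
  have 2: "\<exists>i. i \<in> K \<and> x \<in> cball (ce i) (ra i) \<and> ra i < d" if x: "x \<in> S" and d: "0 < d" for x d
  proof -
    \<comment> \<open>An interval through \<open>x\<close> shorter than \<open>d'\<close> cannot
      leave \<open>U\<close>, so fineness of the covering also yields containment in
      \<open>U\<close>.\<close>
    from U x SU obtain d' where d': "d' > 0" "ball x d' \<subseteq> U"
      by (meson openE subsetD)
    obtain u v where uv: "u \<le> x" "x \<le> v" "u < v" "v - u < min d d'" "P u v"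
      using fine[OF x, of "min d d'"] d d' by auto
    have "{u..v} \<subseteq> ball x d'"
      using uv by (auto simp: dist_real_def)
    then have "(u,v) \<in> K"
      using d' uv by (auto simp: K_def)
    moreover have "ra (u,v) < d" using uv by (auto simp: ra_def)
    ultimately show ?thesis
      using uv by (intro exI[of _ "(u,v)"]) (simp add: cb, simp add: iv_def)
  qed
  obtain C where C: "countable C" "C \<subseteq> K"
    "pairwise (\<lambda>i j. disjnt (cball (ce i) (ra i)) (cball (ce j) (ra j))) C"
    "negligible (S - (\<Union>i\<in>C. cball (ce i) (ra i)))"
    by (rule Vitali_covering_theorem_cballs[of K ra S ce]) (use 1 2 in auto)
  have "iv i \<inter> iv j = {}" if "i \<in> C" "j \<in> C" "i \<noteq> j" for i j
    using C(3) that by (simp add: cb pairwise_def disjnt_def)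
  then have disj: "disjoint (iv ` C)"
    unfolding pairwise_def disjnt_def by (metis imageE)
  have CK: "\<exists>u v. u < v \<and> J = {u..v} \<and> {u..v} \<subseteq> U \<and> P u v" if J: "J \<in> iv ` C" for J
  proof -
    obtain i where "i \<in> C" "J = iv i" using J by blast
    moreover obtain u v where "i = (u,v)" by (cases i)
    ultimately show ?thesis using C(2) by (auto simp: K_def iv_def)
  qed
  have UC: "\<Union>(iv ` C) \<subseteq> U"
    using CK by (metis Union_least)
  have Ul: "U \<in> lmeasurable"
    using U by (simp add: lmeasurable_open)
  have div: "D division_of \<Union>D" if "D \<subseteq> iv ` C" "finite D" for D
  proof (rule division_of_disjoint_intervals[OF that(2)])
    show "disjoint D" using disj that(1) by (rule pairwise_subset)
    fix J assume "J \<in> D"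
    then have "J \<in> iv ` C" using that(1) by blast
    then show "\<exists>u v. u < v \<and> J = {u..v}" using CK[of J] by blast
  qed
  note meas = measure_division(2)[OF div]
  have lm: "J \<in> lmeasurable" if "J \<in> iv ` C" for J
    using CK[OF that] by auto
  have bd: "measure lebesgue (\<Union>D) \<le> measure lebesgue U" if "D \<subseteq> iv ` C" "finite D" for D
  proof (rule measure_mono_fmeasurable[OF _ _ Ul])
    show "\<Union>D \<subseteq> U" using that UC by blast
    show "\<Union>D \<in> sets lebesgue"
      using that lm by (intro sets.finite_Union) (auto intro: fmeasurableD)
  qed
  obtain D where D: "D \<subseteq> iv ` C" "finite D"
    "measure lebesgue (\<Union>(iv ` C)) - e < measure lebesgue (\<Union>D)"
    by (rule measure_countable_Union_approachable[of "iv ` C" e "measure lebesgue U"])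
       (use C(1) e lm bd in auto)
  define T where "T = \<Union>(iv ` C) \<union> (S - \<Union>(iv ` C))"
  have UCm: "\<Union>(iv ` C) \<in> lmeasurable"
    using fmeasurableI2[OF Ul UC] C(1) lm by (simp add: sets.countable_Union fmeasurableD subsetI)
  have neg: "S - \<Union>(iv ` C) \<in> null_sets lebesgue"
    using C(4) by (simp add: cb negligible_iff_null_sets)
  have Tm: "T \<in> lmeasurable" "measure lebesgue T = measure lebesgue (\<Union>(iv ` C))"
    unfolding T_def using measure_Un_null_set[OF fmeasurableD[OF UCm] neg] UCm neg
    by (simp_all del: Un_Diff_cancel add: fmeasurable.Un fmeasurableI_null_sets)
  show ?thesis
  proof (rule that[of D T])
    show "disjoint D" using disj D(1) by (rule pairwise_subset)
    show "\<exists>u v. u < v \<and> J = {u..v} \<and> P u v" if "J \<in> D" for J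
      using that D(1) CK by (meson subsetD)
    show "\<Union>D \<subseteq> U" using D(1) UC by auto
    show "measure lebesgue T < sum (measure lborel) D + e" using D Tm meas[OF D(1,2)] by simp
  qed (use D Tm in \<open>auto simp: T_def\<close>)
qed

lemma sum_increments_division:
  fixes g :: "real \<Rightarrow> real"
  assumes "a \<le> b" "q division_of {a..b}"
  shows "(\<Sum>K\<in>q. g (Sup K) - g (Inf K)) = g b - g a"
proof -
  \<comment> \<open>The tags do not enter the sum; left endpoints make the telescoping lemma for
    tagged divisions applicable.\<close>
  define p where "p = (\<lambda>K. (Inf K, K)) ` q"
  have cl: "\<exists>u v. u \<le> v \<and> K = {u..v}" if "K \<in> q" for K
    using division_ofD(3,4)[OF assms(2) that] by (metis atLeastatMost_empty_iff box_real(2))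
  have "p tagged_division_of {a..b}"
  proof (rule tagged_division_ofI)
    show "finite p" using assms(2) by (auto simp: p_def division_of_def)
    fix x K assume xK: "(x, K) \<in> p"
    then have K: "K \<in> q" "x = Inf K" by (auto simp: p_def)
    from cl[OF K(1)] obtain u v where "u \<le> v" "K = {u..v}" by auto
    then show "x \<in> K" "\<exists>a b. K = cbox a b" using K by auto
    show "K \<subseteq> {a..b}" using division_ofD(2)[OF assms(2) K(1)] .
  next
    fix x1 K1 x2 K2 assume "(x1,K1) \<in> p" "(x2,K2) \<in> p" "(x1,K1) \<noteq> (x2,K2)"
    then show "interior K1 \<inter> interior K2 = {}"
      using division_ofD(5)[OF assms(2)] by (auto simp: p_def)
  next
    show "\<Union> {K. \<exists>x. (x, K) \<in> p} = {a..b}"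
    proof -
      have "{K. \<exists>x. (x, K) \<in> p} = q" by (auto simp: p_def)
      then show ?thesis using division_ofD(6)[OF assms(2)] by simp
    qed
  qed
  then have "(\<Sum>(x,K)\<in>p. g (Sup K) - g (Inf K)) = g b - g a"
    using additive_tagged_division_1[OF assms(1)] by blast
  moreover have "(\<Sum>(x,K)\<in>p. g (Sup K) - g (Inf K)) = (\<Sum>K\<in>q. g (Sup K) - g (Inf K))"
    unfolding p_def by (subst sum.reindex) (auto simp: inj_on_def)
  ultimately show ?thesis by simp
qed

text \<open>Inside each \<open>J\<close> of \<open>D1\<close> the members of \<open>D2\<close> are
  completed to a division of \<open>J\<close>, over which increments telescope. The increments over
  \<open>D1\<close> thus split into those over \<open>D2\<close> and those over the gaps
  \<open>Q - D2\<close>, which absolute continuity controls once the gaps have small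
  measure.\<close>

lemma refine_disjoint_intervals:
  fixes D1 D2 :: "real set set"
  assumes D1: "finite D1" "disjoint D1" "\<And>J. J \<in> D1 \<Longrightarrow> \<exists>u v. u < v \<and> J = {u..v}"
    and D2: "finite D2" "disjoint D2" "\<And>J. J \<in> D2 \<Longrightarrow> \<exists>u v. u < v \<and> J = {u..v}"
    and sub: "\<And>B. B \<in> D2 \<Longrightarrow> \<exists>J\<in>D1. B \<subseteq> J"
  obtains Q where "D2 \<subseteq> Q" "Q division_of \<Union>D1"
    "\<And>g :: real \<Rightarrow> real. (\<Sum>K\<in>Q. g (Sup K) - g (Inf K)) = (\<Sum>J\<in>D1. g (Sup J) - g (Inf J))"
proof -
  have "\<exists>q. {B\<in>D2. B \<subseteq> J} \<subseteq> q \<and> q division_of J" if J: "J \<in> D1" for J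
  proof -
    obtain u v where uv: "u < v" "J = cbox u v" using D1(3)[OF J] by auto
    have "{B\<in>D2. B \<subseteq> J} division_of \<Union>{B\<in>D2. B \<subseteq> J}"
      using D2 by (intro division_of_disjoint_intervals) (auto simp: pairwise_def)
    then show ?thesis
      using partial_division_extend_interval[of "{B\<in>D2. B \<subseteq> J}" u v] uv
      by (metis (no_types, lifting) Union_least mem_Collect_eq)
  qed
  then obtain q where q: "\<And>J. J \<in> D1 \<Longrightarrow> {B\<in>D2. B \<subseteq> J} \<subseteq> q J" "\<And>J. J \<in> D1 \<Longrightarrow> q J division_of J"
    by metis
  define Q where "Q = (\<Union>J\<in>D1. q J)"
  have qsub: "K \<subseteq> J" "K \<noteq> {}" if "K \<in> q J" "J \<in> D1" for K J
    using division_ofD(2,3)[OF q(2)] that by auto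
  have "Q division_of \<Union>D1"
  proof (rule division_ofI)
    show "finite Q" using D1(1) q(2) by (auto simp: Q_def division_of_def)
    fix K assume "K \<in> Q"
    then obtain J where J: "J \<in> D1" "K \<in> q J" by (auto simp: Q_def)
    show "K \<subseteq> \<Union>D1" "K \<noteq> {}" using qsub[OF J(2,1)] J by auto
    show "\<exists>a b. K = cbox a b" using division_ofD(4)[OF q(2)] J by auto
  next
    fix K1 K2 assume "K1 \<in> Q" "K2 \<in> Q" and ne: "K1 \<noteq> K2"
    then obtain J1 J2 where J: "J1 \<in> D1" "K1 \<in> q J1" "J2 \<in> D1" "K2 \<in> q J2" by (auto simp: Q_def)
    show "interior K1 \<inter> interior K2 = {}"
    proof (cases "J1 = J2")
      case True
      then show ?thesis using division_ofD(5)[OF q(2)[OF J(1)]] J ne by auto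
    next
      case False
      then have "J1 \<inter> J2 = {}" using D1(2) J by (auto dest: disjointD)
      then have "K1 \<inter> K2 = {}" using qsub J by blast
      then show ?thesis by (metis interior_Int interior_empty)
    qed
  next
    show "\<Union>Q = \<Union>D1"
    proof -
      have "\<Union>(q J) = J" if "J \<in> D1" for J using division_ofD(6)[OF q(2)[OF that]] .
      then show ?thesis unfolding Q_def by blast
    qed
  qed
  moreover have "D2 \<subseteq> Q"
    unfolding Q_def using sub q(1) by blast
  moreover have "(\<Sum>K\<in>Q. g (Sup K) - g (Inf K)) = (\<Sum>J\<in>D1. g (Sup J) - g (Inf J))"
    for g :: "real \<Rightarrow> real"
  proof -
    have "(\<Sum>K\<in>Q. g (Sup K) - g (Inf K)) = (\<Sum>J\<in>D1. \<Sum>K\<in>q J. g (Sup K) - g (Inf K))"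
      unfolding Q_def
    proof (rule sum.UNION_disjoint)
      show "\<forall>J\<in>D1. finite (q J)" using q(2) by (auto simp: division_of_def)
      show "\<forall>J\<in>D1. \<forall>J'\<in>D1. J \<noteq> J' \<longrightarrow> q J \<inter> q J' = {}"
      proof (intro ballI impI)
        fix J J' assume J: "J \<in> D1" "J' \<in> D1" "J \<noteq> J'"
        then have "J \<inter> J' = {}" using D1(2) by (auto dest: disjointD)
        show "q J \<inter> q J' = {}"
        proof (rule ccontr)
          assume "q J \<inter> q J' \<noteq> {}"
          then obtain K where "K \<in> q J" "K \<in> q J'" by blast
          then have "K \<subseteq> J \<inter> J'" "K \<noteq> {}" using qsub J by auto
          then show False using \<open>J \<inter> J' = {}\<close> by simp
        qed
      qed
    qed (use D1 in auto)
    also have "\<dots> = (\<Sum>J\<in>D1. g (Sup J) - g (Inf J))"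
    proof (rule sum.cong)
      fix J assume J: "J \<in> D1"
      obtain u v where "u < v" "J = {u..v}" using D1(3)[OF J] by auto
      then show "(\<Sum>K\<in>q J. g (Sup K) - g (Inf K)) = g (Sup J) - g (Inf J)"
        using sum_increments_division[of u v "q J" g] q(2)[OF J] by simp
    qed simp
    finally show ?thesis .
  qed
  ultimately show ?thesis by (intro that[of Q])
qed

lemma absolutely_continuous_onD:
  assumes "absolutely_continuous_on S f" "e > 0"
  obtains d where "d > 0" "\<And>D. D division_of \<Union>D \<Longrightarrow> \<Union>D \<subseteq> S \<Longrightarrow> (\<Sum>J\<in>D. measure lborel J) < d
        \<Longrightarrow> (\<Sum>J\<in>D. cmod (f (Sup J) - f (Inf J))) < e"
  using assms that unfolding absolutely_continuous_on_def by meson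

lemma absolutely_continuous_on_realD:
  fixes f :: "real \<Rightarrow> real"
  assumes "absolutely_continuous_on S (\<lambda>x. complex_of_real (f x))" "e > 0"
  obtains d where "d > 0" "\<And>D. D division_of \<Union>D \<Longrightarrow> \<Union>D \<subseteq> S \<Longrightarrow> (\<Sum>J\<in>D. measure lborel J) < d
        \<Longrightarrow> (\<Sum>J\<in>D. \<bar>f (Sup J) - f (Inf J)\<bar>) < e"
proof -
  have eq: "cmod (complex_of_real (f x) - complex_of_real (f y)) = \<bar>f x - f y\<bar>" for x y
    by (metis norm_of_real of_real_diff)
  obtain d where d: "d > 0" "\<And>D. D division_of \<Union>D \<Longrightarrow> \<Union>D \<subseteq> S \<Longrightarrow> (\<Sum>J\<in>D. measure lborel J) < d
        \<Longrightarrow> (\<Sum>J\<in>D. cmod (complex_of_real (f (Sup J)) - complex_of_real (f (Inf J)))) < e"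
    by (rule absolutely_continuous_onD[OF assms]) blast
  show ?thesis by (rule that[OF d(1)]) (use d(2) in \<open>simp only: eq\<close>)
qed

text \<open>A Vitali covering of \<open>S\<close> by intervals of small slope is refined by one by intervals of large
  slope; what is left over has small measure, so by absolute continuity it hardly contributes to the
  increments.\<close>

lemma negligible_slope_crossing:
  fixes f :: "real \<Rightarrow> real"
  assumes ac: "absolutely_continuous_on {a..b} (\<lambda>x. complex_of_real (f x))"
    and S: "S \<subseteq> {a<..<b}" and ab: "\<alpha> < \<beta>"
    and low: "\<And>x d. x \<in> S \<Longrightarrow> d > 0 \<Longrightarrow>
        \<exists>u v. u \<le> x \<and> x \<le> v \<and> u < v \<and> v - u < d \<and> f v - f u < \<alpha> * (v - u)"
    and high: "\<And>x d. x \<in> S \<Longrightarrow> d > 0 \<Longrightarrow>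
        \<exists>u v. u \<le> x \<and> x \<le> v \<and> u < v \<and> v - u < d \<and> f v - f u > \<beta> * (v - u)"
  shows "negligible S"
proof -
  \<comment> \<open>\<open>m\<close> is the outer measure of \<open>S\<close>, whose measurability
    is not known. If \<open>m > 0\<close>, comparing the two kinds of slopes gives a
    contradiction.\<close>
  define M where "M = {measure lebesgue T | T. T \<in> lmeasurable \<and> S \<subseteq> T}"
  define m where "m = Inf M"
  have ne: "M \<noteq> {}"
    using S by (auto simp: M_def intro!: exI[of _ "{a<..<b}"])
  have bdd: "bdd_below M"
    by (auto simp: M_def intro!: bdd_belowI[of _ 0])
  have mle: "m \<le> measure lebesgue T" if "T \<in> lmeasurable" "S \<subseteq> T" for T
    unfolding m_def using that by (intro cInf_lower bdd) (auto simp: M_def)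
  have mex: "\<exists>T. T \<in> lmeasurable \<and> S \<subseteq> T \<and> measure lebesgue T < m + e" if "e > 0" for e
    using cInf_lessD[OF ne, of "m + e"] that by (auto simp: M_def m_def)
  show ?thesis
  proof (cases "m > 0")
    case False
    then show ?thesis
      unfolding negligible_outer by (smt (verit) mex)
  next
    case m: True
    define \<eta> where "\<eta> = (\<beta> - \<alpha>) * m / 4"
    have \<eta>: "\<eta> > 0" using m ab by (simp add: \<eta>_def)
    obtain \<delta> where \<delta>: "\<delta> > 0" and acd: "\<And>D. D division_of \<Union>D \<Longrightarrow> \<Union>D \<subseteq> {a..b} \<Longrightarrow>
        (\<Sum>J\<in>D. measure lborel J) < \<delta> \<Longrightarrow> (\<Sum>J\<in>D. \<bar>f (Sup J) - f (Inf J)\<bar>) < \<eta>"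
      using absolutely_continuous_on_realD[OF ac \<eta>] by blast
    \<comment> \<open>The coefficients anticipate the losses \<open>s2 > m - 4 * e\<close> and
      \<open>s1 - s2 < 6 * e\<close>. Half of \<open>(\<beta> - \<alpha>) * m\<close> pays for them
      and a quarter for \<open>\<eta>\<close>, which leaves a positive amount. The
      \<open>\<delta> / 7\<close> in \<open>e\<close> makes the gaps, of measure below
      \<open>6 * e\<close>, short enough for absolute continuity.\<close>
    define Q where "Q = 4 * (\<beta> - \<alpha>) + 6 * \<bar>\<alpha>\<bar>"
    have Q: "Q > 0" using ab by (simp add: Q_def add_pos_nonneg)
    define e where "e = min (\<delta> / 7) ((\<beta> - \<alpha>) * m / (2 * Q))"
    have e: "e > 0" "6 * e < \<delta>" "e * Q \<le> (\<beta> - \<alpha>) * m / 2"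
    proof -
      show "e > 0" using \<delta> Q m ab by (simp add: e_def)
      have "e \<le> \<delta> / 7" by (simp add: e_def)
      then show "6 * e < \<delta>" using \<delta> by linarith
      have "e \<le> (\<beta> - \<alpha>) * m / (2 * Q)" by (simp add: e_def)
      then show "e * Q \<le> (\<beta> - \<alpha>) * m / 2" using Q by (simp add: field_simps)
    qed
    obtain T0 where T0: "T0 \<in> lmeasurable" "S \<subseteq> T0" "measure lebesgue T0 < m + e"
      using mex[OF e(1)] by blast
    obtain U0 where U0: "open U0" "T0 \<subseteq> U0" "U0 - T0 \<in> lmeasurable"
      "emeasure lebesgue (U0 - T0) < ennreal e"
      using sets_lebesgue_outer_open[OF fmeasurableD[OF T0(1)] e(1)] by metis
    have U0m: "measure lebesgue (U0 - T0) < e"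
      using U0 e by (simp add: emeasure_eq_measure2 ennreal_less_iff)
    define U where "U = U0 \<inter> {a<..<b}"
    have U: "open U" "bounded U" "S \<subseteq> U" "U \<subseteq> {a..b}"
      using U0 S T0 by (auto simp: U_def bounded_Int intro!: open_Int)
    have Ul: "U \<in> lmeasurable" using U by (simp add: lmeasurable_open)
    have Um: "measure lebesgue U < m + 2 * e"
    proof -
      have "measure lebesgue U \<le> measure lebesgue (T0 \<union> (U0 - T0))"
        using Ul T0 U0 by (intro measure_mono_fmeasurable) (auto simp: U_def simp del: Un_Diff_cancel)
      also have "\<dots> \<le> measure lebesgue T0 + measure lebesgue (U0 - T0)"
        using T0 U0 by (intro measure_Un_le) auto
      finally show ?thesis using T0 U0m by simp
    qed
    obtain D1 T1 where D1: "finite D1" "disjoint D1"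
        "\<And>J. J \<in> D1 \<Longrightarrow> \<exists>u v. u < v \<and> J = {u..v} \<and> f v - f u < \<alpha> * (v - u)"
        "\<Union>D1 \<subseteq> U" "T1 \<in> lmeasurable" "S \<subseteq> T1" "measure lebesgue T1 < sum (measure lborel) D1 + e"
      using Vitali_intervals_finite[OF U(1,2,3) e(1), of "\<lambda>u v. f v - f u < \<alpha> * (v - u)", OF low]
      by blast
    have D1': "\<exists>u v. u < v \<and> J = {u..v}" if "J \<in> D1" for J using D1(3)[OF that] by auto
    note div1 = division_of_disjoint_intervals[OF D1(1,2) D1']
    define s1 where "s1 = sum (measure lborel) D1"
    have s1: "s1 > m - e" "s1 < m + 2 * e"
    proof -
      show "s1 > m - e" using mle[OF D1(5,6)] D1(7) by (simp add: s1_def)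
      have "s1 \<le> measure lebesgue U"
        using measure_mono_fmeasurable[OF D1(4) _ Ul] measure_division[OF div1]
        by (auto simp: s1_def fmeasurableD)
      then show "s1 < m + 2 * e" using Um by simp
    qed
    \<comment> \<open>Only around interior points is there room for steep intervals inside a single
      member of \<open>D1\<close>; the endpoints given up have measure zero.\<close>
    define U1 where "U1 = (\<Union>J\<in>D1. interior J)"
    define S1 where "S1 = S \<inter> U1"
    have U1: "open U1" "bounded U1" "U1 \<subseteq> \<Union>D1" "S1 \<subseteq> U1"
    proof -
      show U1s: "U1 \<subseteq> \<Union>D1" using interior_subset by (auto simp: U1_def)
      show "bounded U1" using U1s D1(4) U(2) by (meson bounded_subset)
    qed (auto simp: U1_def S1_def)
    have fine2: "\<exists>u v. u \<le> x \<and> x \<le> v \<and> u < v \<and> v - u < d \<and>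
        (f v - f u > \<beta> * (v - u) \<and> (\<exists>J\<in>D1. {u..v} \<subseteq> J))" if x: "x \<in> S1" and d: "d > 0" for x d
    proof -
      obtain J where J: "J \<in> D1" "x \<in> interior J" using x by (auto simp: S1_def U1_def)
      obtain d' where d': "d' > 0" "ball x d' \<subseteq> interior J"
        using J open_interior by (metis openE)
      obtain u v where uv: "u \<le> x" "x \<le> v" "u < v" "v - u < min d d'" "f v - f u > \<beta> * (v - u)"
        using high[of x "min d d'"] x d d' by (auto simp: S1_def)
      have "{u..v} \<subseteq> ball x d'" using uv by (auto simp: dist_real_def)
      then have "{u..v} \<subseteq> J" using d' interior_subset by blast
      then show ?thesis using uv J by auto
    qed
    obtain D2 T2 where D2: "finite D2" "disjoint D2"
        "\<And>J. J \<in> D2 \<Longrightarrow> \<exists>u v. u < v \<and> J = {u..v} \<and> (f v - f u > \<beta> * (v - u) \<and> (\<exists>J\<in>D1. {u..v} \<subseteq> J))"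
        "\<Union>D2 \<subseteq> U1" "T2 \<in> lmeasurable" "S1 \<subseteq> T2" "measure lebesgue T2 < sum (measure lborel) D2 + e"
      using Vitali_intervals_finite[OF U1(1,2,4) e(1),
          of "\<lambda>u v. f v - f u > \<beta> * (v - u) \<and> (\<exists>J\<in>D1. {u..v} \<subseteq> J)", OF fine2]
      by blast
    have D2': "\<exists>u v. u < v \<and> J = {u..v}" if "J \<in> D2" for J using D2(3)[OF that] by auto
    note div2 = division_of_disjoint_intervals[OF D2(1,2) D2']
    have sub: "\<exists>J\<in>D1. B \<subseteq> J" if "B \<in> D2" for B using D2(3)[OF that] by auto
    define s2 where "s2 = sum (measure lborel) D2"
    have U1m: "measure lebesgue U1 = s1"
    proof -
      have eq: "measure lebesgue (interior J) = measure lborel J" "interior J \<in> lmeasurable" if "J \<in> D1" for J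
        using D1'[OF that] by (auto simp: interior_atLeastAtMost_real)
      have "measure lebesgue U1 = (\<Sum>J\<in>D1. measure lebesgue (interior J))"
        unfolding U1_def
      proof (rule measure_UNION_AE[symmetric, THEN sym])
        show "pairwise (\<lambda>m n. AE x in lebesgue. x \<notin> interior m \<or> x \<notin> interior n) D1"
        proof (rule pairwiseI)
          fix J J' assume "J \<in> D1" "J' \<in> D1" "J \<noteq> J'"
          then have "J \<inter> J' = {}" using D1(2) by (auto dest: disjointD)
          then show "AE x in lebesgue. x \<notin> interior J \<or> x \<notin> interior J'"
            using interior_subset by (intro AE_I2) blast
        qed
      qed (use D1(1) eq in auto)
      then show ?thesis using eq by (simp add: s1_def)
    qed
    have s2: "s2 > m - 4 * e"
    proof -
      \<comment> \<open>\<open>U - U1\<close> has measure below \<open>3 * e\<close>, because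
        \<open>U\<close> stays under \<open>m + 2 * e\<close> while \<open>s1 > m - e\<close>; and
        \<open>T2\<close> exceeds \<open>s2\<close> by less than \<open>e\<close>.\<close>
      have "S \<subseteq> T2 \<union> (U - U1)" using D2(6) U(3) by (auto simp: S1_def)
      moreover have U1l: "U1 \<in> lmeasurable" using U1 by (simp add: lmeasurable_open)
      moreover have "U1 \<subseteq> U" using U1 D1(4) by blast
      ultimately have "m \<le> measure lebesgue (T2 \<union> (U - U1))"
        using D2(5) Ul by (intro mle) auto
      also have "\<dots> \<le> measure lebesgue T2 + measure lebesgue (U - U1)"
        using D2(5) Ul U1l by (intro measure_Un_le) auto
      also have "measure lebesgue (U - U1) = measure lebesgue U - s1"
        using \<open>U1 \<subseteq> U\<close> U1l Ul U1m by (simp add: measurable_measure_Diff fmeasurableD)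
      finally show ?thesis using D2(7) Um s1 by (simp add: s2_def)
    qed
    obtain q where q: "D2 \<subseteq> q" "q division_of \<Union>D1"
      "\<And>g :: real \<Rightarrow> real. (\<Sum>K\<in>q. g (Sup K) - g (Inf K)) = (\<Sum>J\<in>D1. g (Sup J) - g (Inf J))"
      using refine_disjoint_intervals[OF D1(1,2) D1' D2(1,2) D2' sub] by metis
    define R where "R = q - D2"
    have fq: "finite q" using q(2) by (simp add: division_of_def)
    have divR: "R division_of \<Union>R"
      using division_of_subset[OF division_of_union_self[OF q(2)], of R] by (auto simp: R_def)
    have Rs: "\<Union>R \<subseteq> {a..b}"
    proof -
      have "\<Union>R \<subseteq> \<Union>q" by (auto simp: R_def)
      then show ?thesis using division_ofD(6)[OF q(2)] D1(4) U(4) by simp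
    qed
    have sq: "sum g q = sum g D2 + sum g R" for g :: "real set \<Rightarrow> real"
      unfolding R_def using sum.subset_diff[OF q(1) fq] by (simp add: add.commute)
    have mq: "sum (measure lborel) q = s1"
      using measure_division(2)[OF q(2)] measure_division(2)[OF div1] by (simp add: s1_def)
    have mR: "sum (measure lborel) R = s1 - s2"
      using sq[of "measure lborel"] mq by (simp add: s2_def)
    have s21: "s1 - s2 < 6 * e" using s1 s2 by simp
    define F where "F = (\<lambda>J. f (Sup J) - f (Inf J))"
    have "(\<Sum>J\<in>R. \<bar>F J\<bar>) < \<eta>"
      unfolding F_def using acd[OF divR Rs] mR s21 e(2) by simp
    then have FR: "sum F R > - \<eta>"
      using sum_abs[of F R] by linarith
    have FD1: "sum F D1 \<le> \<alpha> * s1"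
      unfolding s1_def sum_distrib_left
    proof (rule sum_mono)
      fix J assume "J \<in> D1"
      then obtain u v where "u < v" "J = {u..v}" "f v - f u < \<alpha> * (v - u)" using D1(3) by blast
      then show "F J \<le> \<alpha> * measure lborel J" by (simp add: F_def)
    qed
    have FD2: "\<beta> * s2 \<le> sum F D2"
      unfolding s2_def sum_distrib_left
    proof (rule sum_mono)
      fix J assume "J \<in> D2"
      then obtain u v where "u < v" "J = {u..v}" "f v - f u > \<beta> * (v - u)" using D2(3) by blast
      then show "\<beta> * measure lborel J \<le> F J" by (simp add: F_def)
    qed
    have "sum F q = sum F D1" using q(3)[of f] by (simp add: F_def)
    \<comment> \<open>One total increment, read in two ways: at most \<open>\<alpha> * s1\<close>
      over \<open>D1\<close>, and more than \<open>\<beta> * s2 - \<eta>\<close> over its refinement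
      \<open>q\<close>.\<close>
    then have main: "\<beta> * s2 - \<alpha> * s1 < \<eta>"
      using sq[of F] FR FD1 FD2 by linarith
    have "s1 - s2 \<ge> 0"
      using mR sum_nonneg[of R "measure lborel"] by simp
    then have "\<alpha> * (s1 - s2) \<le> \<bar>\<alpha>\<bar> * (6 * e)"
      using s21 by (smt (verit) mult_left_mono mult_right_mono)
    moreover have "(\<beta> - \<alpha>) * s2 \<ge> (\<beta> - \<alpha>) * (m - 4 * e)"
      using s2 ab by (intro mult_left_mono) auto
    moreover have "\<beta> * s2 - \<alpha> * s1 = (\<beta> - \<alpha>) * s2 - \<alpha> * (s1 - s2)"
      by (simp add: algebra_simps)
    ultimately have "(\<beta> - \<alpha>) * m - e * Q < \<eta>"
      using main by (simp add: Q_def algebra_simps)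
    then have "(\<beta> - \<alpha>) * m < 0" using e(3) unfolding \<eta>_def by linarith
    then show ?thesis using m ab by (simp add: mult_less_0_iff)
  qed
qed

text \<open>In a window of length \<open>\<delta> / 2\<close> disjoint intervals have total
  increment below 1, so slopes above \<open>t = 2 / e\<close> force their total length below
  \<open>e / 2\<close>; the other \<open>e / 2\<close> is the Vitali error. Windows with rational
  left ends cover the line.\<close>

lemma negligible_unbounded_slopes:
  fixes f :: "real \<Rightarrow> real"
  assumes ac: "absolutely_continuous_on {a..b} (\<lambda>x. complex_of_real (f x))"
    and S: "S \<subseteq> {a<..<b}"
    and unb: "\<And>x t d. x \<in> S \<Longrightarrow> d > 0 \<Longrightarrow>
        \<exists>u v. u \<le> x \<and> x \<le> v \<and> u < v \<and> v - u < d \<and> \<bar>f v - f u\<bar> > t * (v - u)"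
  shows "negligible S"
proof -
  obtain \<delta> where \<delta>: "\<delta> > 0" and acd: "\<And>D. D division_of \<Union>D \<Longrightarrow> \<Union>D \<subseteq> {a..b} \<Longrightarrow>
      (\<Sum>J\<in>D. measure lborel J) < \<delta> \<Longrightarrow> (\<Sum>J\<in>D. \<bar>f (Sup J) - f (Inf J)\<bar>) < 1"
    using absolutely_continuous_on_realD[OF ac zero_less_one] by blast
  have *: "negligible (S \<inter> {c<..<c + \<delta> / 2})" for c
    unfolding negligible_outer
  proof (intro allI impI)
    fix e :: real assume e: "e > 0"
    define t where "t = 2 / e"
    define U where "U = {a<..<b} \<inter> {c<..<c + \<delta> / 2}"
    have U: "open U" "bounded U" "S \<inter> {c<..<c + \<delta> / 2} \<subseteq> U"
      using S by (auto simp: U_def bounded_Int)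
    have fine: "\<exists>u v. u \<le> x \<and> x \<le> v \<and> u < v \<and> v - u < d \<and> \<bar>f v - f u\<bar> > t * (v - u)"
      if "x \<in> S \<inter> {c<..<c + \<delta> / 2}" "d > 0" for x d
      using unb that by blast
    obtain D T where D: "finite D" "disjoint D"
        "\<And>J. J \<in> D \<Longrightarrow> \<exists>u v. u < v \<and> J = {u..v} \<and> \<bar>f v - f u\<bar> > t * (v - u)"
        "\<Union>D \<subseteq> U" "T \<in> lmeasurable" "S \<inter> {c<..<c + \<delta> / 2} \<subseteq> T"
        "measure lebesgue T < sum (measure lborel) D + e / 2"
      using Vitali_intervals_finite[OF U, of "e/2" "\<lambda>u v. \<bar>f v - f u\<bar> > t * (v - u)"] e fine
      by (metis half_gt_zero)
    have D': "\<exists>u v. u < v \<and> J = {u..v}" if "J \<in> D" for J using D(3)[OF that] by auto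
    note div = division_of_disjoint_intervals[OF D(1,2) D']
    have "sum (measure lborel) D \<le> measure lebesgue {c..c + \<delta> / 2}"
    proof -
      have "\<Union>D \<subseteq> {c..c + \<delta> / 2}" using D(4) by (auto simp: U_def)
      then have "measure lebesgue (\<Union>D) \<le> measure lebesgue {c..c + \<delta> / 2}"
        using measure_division[OF div] by (intro measure_mono_fmeasurable) (auto simp: fmeasurableD)
      then show ?thesis using measure_division[OF div] by simp
    qed
    then have "sum (measure lborel) D < \<delta>" using \<delta> by simp
    moreover have "\<Union>D \<subseteq> {a..b}" using D(4) by (force simp: U_def)
    ultimately have "(\<Sum>J\<in>D. \<bar>f (Sup J) - f (Inf J)\<bar>) < 1"
      using acd[OF div] by simp
    moreover have "t * sum (measure lborel) D \<le> (\<Sum>J\<in>D. \<bar>f (Sup J) - f (Inf J)\<bar>)"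
      unfolding sum_distrib_left
    proof (rule sum_mono)
      fix J assume "J \<in> D"
      then obtain u v where "u < v" "J = {u..v}" "\<bar>f v - f u\<bar> > t * (v - u)" using D(3) by blast
      then show "t * measure lborel J \<le> \<bar>f (Sup J) - f (Inf J)\<bar>" by simp
    qed
    ultimately have "t * sum (measure lborel) D < 1" by simp
    then have "sum (measure lborel) D < e / 2" using e by (simp add: t_def field_simps)
    then show "\<exists>T. S \<inter> {c<..<c + \<delta> / 2} \<subseteq> T \<and> T \<in> lmeasurable \<and> measure lebesgue T < e"
      using D(5-7) by (intro exI[of _ T]) simp
  qed
  have "negligible (\<Union>c\<in>\<rat>. S \<inter> {c<..<c + \<delta> / 2})"
    using * by (intro negligible_countable_Union countable_image countable_rat) auto
  moreover have "S \<subseteq> (\<Union>c\<in>\<rat>. S \<inter> {c<..<c + \<delta> / 2})"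
  proof
    fix x assume x: "x \<in> S"
    obtain c where "c \<in> \<rat>" "x - \<delta> / 2 < c" "c < x"
      using Rats_dense_in_real[of "x - \<delta> / 2" x] \<delta> by auto
    then show "x \<in> (\<Union>c\<in>\<rat>. S \<inter> {c<..<c + \<delta> / 2})" using x by force
  qed
  ultimately show ?thesis using negligible_subset by blast
qed

text \<open>The limit is the supremum of the eventual lower bounds. Above it two rationals are
  inserted: the smaller is not an eventual lower bound, so the cut makes the larger an eventual
  upper bound.\<close>

lemma convergent_by_rational_cuts:
  fixes q :: "'a \<Rightarrow> real"
  assumes F: "F \<noteq> bot" and bd: "\<forall>\<^sub>F y in F. \<bar>q y\<bar> \<le> t"
    and cut: "\<And>\<alpha> \<beta>. \<alpha> \<in> \<rat> \<Longrightarrow> \<beta> \<in> \<rat> \<Longrightarrow> \<alpha> < \<beta> \<Longrightarrow> (\<forall>\<^sub>F y in F. q y \<ge> \<alpha>) \<or> (\<forall>\<^sub>F y in F. q y \<le> \<beta>)"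
  obtains L where "(q \<longlongrightarrow> L) F"
proof -
  define A where "A = {\<alpha>. \<forall>\<^sub>F y in F. q y \<ge> \<alpha>}"
  have "- t \<in> A" using bd by (auto simp: A_def elim!: eventually_mono)
  then have ne: "A \<noteq> {}" by blast
  have bdd: "bdd_above A"
  proof (rule bdd_aboveI)
    fix \<alpha> assume "\<alpha> \<in> A"
    then have "\<forall>\<^sub>F y in F. \<alpha> \<le> q y \<and> \<bar>q y\<bar> \<le> t"
      using bd by (auto simp: A_def intro: eventually_conj)
    then obtain y where "\<alpha> \<le> q y \<and> \<bar>q y\<bar> \<le> t"
      using F eventually_happens' by blast
    then show "\<alpha> \<le> t" by auto
  qed
  have "(q \<longlongrightarrow> Sup A) F"
  proof (rule order_tendstoI)
    fix c assume "c < Sup A"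
    then obtain \<alpha> where "\<alpha> \<in> A" "c < \<alpha>"
      using less_cSup_iff[OF ne bdd] by auto
    then show "\<forall>\<^sub>F y in F. c < q y"
      by (auto simp: A_def elim: eventually_mono)
  next
    fix c assume "Sup A < c"
    obtain \<beta> where \<beta>: "\<beta> \<in> \<rat>" "Sup A < \<beta>" "\<beta> < c" using Rats_dense_in_real[OF \<open>Sup A < c\<close>] by auto
    obtain \<alpha> where \<alpha>: "\<alpha> \<in> \<rat>" "Sup A < \<alpha>" "\<alpha> < \<beta>" using Rats_dense_in_real[OF \<beta>(2)] by auto
    have "\<alpha> \<notin> A" using cSup_upper[OF _ bdd, of \<alpha>] \<alpha> by auto
    then have "\<forall>\<^sub>F y in F. q y \<le> \<beta>" using cut[OF \<alpha>(1) \<beta>(1) \<alpha>(3)] by (auto simp: A_def)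
    then show "\<forall>\<^sub>F y in F. q y < c" using \<beta>(3) by (auto elim: eventually_mono)
  qed
  then show ?thesis by (rule that)
qed

text \<open>The exceptional sets use intervals that merely contain \<open>x\<close>, as the Vitali
  arguments require. Difference quotients at \<open>x\<close> are slopes of such intervals, so off
  the countable union they are bounded near \<open>x\<close> and satisfy one side of every rational
  cut.\<close>

lemma absolutely_continuous_on_differentiable_ae_real:
  fixes f :: "real \<Rightarrow> real"
  assumes ac: "absolutely_continuous_on {a..b} (\<lambda>x. complex_of_real (f x))"
  obtains N where "negligible N" "\<And>x. x \<in> {a<..<b} - N \<Longrightarrow> \<exists>D. (f has_real_derivative D) (at x)"
proof -
  define E where "E = (\<lambda>(\<alpha>::real, \<beta>::real). {x\<in>{a<..<b}.
     (\<forall>d>0. \<exists>u v. u \<le> x \<and> x \<le> v \<and> u < v \<and> v - u < d \<and> f v - f u < \<alpha> * (v - u)) \<and>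
     (\<forall>d>0. \<exists>u v. u \<le> x \<and> x \<le> v \<and> u < v \<and> v - u < d \<and> f v - f u > \<beta> * (v - u))})"
  define E' where "E' = {x\<in>{a<..<b}.
     (\<forall>t. \<forall>d>0. \<exists>u v. u \<le> x \<and> x \<le> v \<and> u < v \<and> v - u < d \<and> \<bar>f v - f u\<bar> > t * (v - u))}"
  define N where "N = E' \<union> (\<Union>z\<in>{(\<alpha>,\<beta>). \<alpha> \<in> \<rat> \<and> \<beta> \<in> \<rat> \<and> \<alpha> < \<beta>}. E z)"
  have "negligible E'"
    by (rule negligible_unbounded_slopes[OF ac]) (auto simp: E'_def)
  moreover have "negligible (E (\<alpha>,\<beta>))" if "\<alpha> < \<beta>" for \<alpha> \<beta>
    by (rule negligible_slope_crossing[OF ac _ that]) (auto simp: E_def)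
  moreover have "countable {(\<alpha>::real,\<beta>::real). \<alpha> \<in> \<rat> \<and> \<beta> \<in> \<rat> \<and> \<alpha> < \<beta>}"
    by (rule countable_subset[of _ "\<rat> \<times> \<rat>"]) (auto simp: countable_rat)
  ultimately have N: "negligible N"
    unfolding N_def by (intro negligible_Un negligible_countable_Union countable_image) auto
  have "\<exists>D. (f has_real_derivative D) (at x)" if x: "x \<in> {a<..<b} - N" for x
  proof -
    define q where "q = (\<lambda>y. (f y - f x) / (y - x))"
    have slope: "\<exists>u v. u \<le> x \<and> x \<le> v \<and> u < v \<and> v - u = \<bar>y - x\<bar> \<and> f v - f u = q y * (v - u)"
      if "y \<noteq> x" for y
      using that unfolding q_def
      by (cases "y > x"; intro exI[of _ "min x y"] exI[of _ "max x y"]) (auto simp: min_def max_def field_simps)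
    have ev: "eventually (\<lambda>y. P (q y)) (at x)"
      if "d > 0" and P: "\<And>u v. u \<le> x \<Longrightarrow> x \<le> v \<Longrightarrow> u < v \<Longrightarrow> v - u < d \<Longrightarrow> P ((f v - f u) / (v - u))" for P d
      unfolding eventually_at
    proof (intro exI[of _ d] conjI ballI impI)
      fix y assume "y \<noteq> x \<and> dist y x < d"
      then obtain u v where "u \<le> x" "x \<le> v" "u < v" "v - u < d" "f v - f u = q y * (v - u)"
        using slope[of y] by (auto simp: dist_real_def)
      then show "P (q y)" using P[of u v] by simp
    qed (use that in auto)
    have "x \<notin> E'" using x by (auto simp: N_def)
    then obtain t d where "d > 0" and td:
      "\<And>u v. u \<le> x \<Longrightarrow> x \<le> v \<Longrightarrow> u < v \<Longrightarrow> v - u < d \<Longrightarrow> \<bar>f v - f u\<bar> \<le> t * (v - u)"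
      using x unfolding E'_def by (simp add: not_less) (metis not_le)
    then have 1: "\<forall>\<^sub>F y in at x. \<bar>q y\<bar> \<le> t"
      by (intro ev[of d]) (auto simp: field_simps)
    have 2: "(\<forall>\<^sub>F y in at x. q y \<ge> \<alpha>) \<or> (\<forall>\<^sub>F y in at x. q y \<le> \<beta>)"
      if "\<alpha> \<in> \<rat>" "\<beta> \<in> \<rat>" "\<alpha> < \<beta>" for \<alpha> \<beta>
    proof -
      have "x \<notin> E (\<alpha>,\<beta>)" using x that by (auto simp: N_def)
      then consider d where "d > 0" "\<And>u v. u \<le> x \<Longrightarrow> x \<le> v \<Longrightarrow> u < v \<Longrightarrow> v - u < d \<Longrightarrow> f v - f u \<ge> \<alpha> * (v - u)"
        | d where "d > 0" "\<And>u v. u \<le> x \<Longrightarrow> x \<le> v \<Longrightarrow> u < v \<Longrightarrow> v - u < d \<Longrightarrow> f v - f u \<le> \<beta> * (v - u)"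
        using x unfolding E_def by (simp add: not_less) (metis not_le)
      then show ?thesis
      proof cases
        case 1
        then have "\<forall>\<^sub>F y in at x. q y \<ge> \<alpha>" by (intro ev[of d]) (auto simp: field_simps)
        then show ?thesis ..
      next
        case 2
        then have "\<forall>\<^sub>F y in at x. q y \<le> \<beta>" by (intro ev[of d]) (auto simp: field_simps)
        then show ?thesis ..
      qed
    qed
    obtain L where "(q \<longlongrightarrow> L) (at x)"
      using convergent_by_rational_cuts[OF _ 1 2] by auto
    then show ?thesis by (auto simp: has_field_derivative_iff q_def)
  qed
  then show ?thesis using that N by blast
qed

section \<open>Complex-valued functions and the fundamental theorem of calculus\<close>

lemma absolutely_continuous_on_mono_increments:
  assumes "absolutely_continuous_on S f" "\<And>x y. cmod (g x - g y) \<le> cmod (f x - f y)"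
  shows "absolutely_continuous_on S g"
  unfolding absolutely_continuous_on_def
proof (intro allI impI)
  fix e :: real assume "e > 0"
  then obtain d where d: "d > 0" "\<And>D. D division_of \<Union>D \<and> \<Union>D \<subseteq> S \<and> (\<Sum>J\<in>D. measure lborel J) < d
        \<Longrightarrow> (\<Sum>J\<in>D. cmod (f (Sup J) - f (Inf J))) < e"
    using assms(1) unfolding absolutely_continuous_on_def by meson
  have "(\<Sum>J\<in>D. cmod (g (Sup J) - g (Inf J))) < e"
    if "D division_of \<Union>D \<and> \<Union>D \<subseteq> S \<and> (\<Sum>J\<in>D. measure lborel J) < d" for D
    using sum_mono[of D "\<lambda>J. cmod (g (Sup J) - g (Inf J))" "\<lambda>J. cmod (f (Sup J) - f (Inf J))"]
      assms(2) d(2)[OF that] by (meson le_less_trans)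
  then show "\<exists>\<delta>>0. \<forall>D. D division_of \<Union>D \<and> \<Union>D \<subseteq> S \<and> (\<Sum>J\<in>D. measure lborel J) < \<delta>
        \<longrightarrow> (\<Sum>J\<in>D. cmod (g (Sup J) - g (Inf J))) < e"
    using d(1) by blast
qed

lemma absolutely_continuous_on_differentiable_ae:
  assumes ac: "absolutely_continuous_on {a..b} f"
  obtains N where "negligible N" "\<And>x. x \<in> {a<..<b} - N \<Longrightarrow> \<exists>D. (f has_vector_derivative D) (at x)"
proof -
  have 1: "absolutely_continuous_on {a..b} (\<lambda>x. complex_of_real (Re (f x)))"
  proof (rule absolutely_continuous_on_mono_increments[OF ac])
    show "cmod (complex_of_real (Re (f x)) - complex_of_real (Re (f y))) \<le> cmod (f x - f y)" for x y
      using abs_Re_le_cmod[of "f x - f y"] by (metis minus_complex.sel(1) norm_of_real of_real_diff)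
  qed
  have 2: "absolutely_continuous_on {a..b} (\<lambda>x. complex_of_real (Im (f x)))"
  proof (rule absolutely_continuous_on_mono_increments[OF ac])
    show "cmod (complex_of_real (Im (f x)) - complex_of_real (Im (f y))) \<le> cmod (f x - f y)" for x y
      using abs_Im_le_cmod[of "f x - f y"] by (metis minus_complex.sel(2) norm_of_real of_real_diff)
  qed
  obtain N1 where N1: "negligible N1"
      "\<And>x. x \<in> {a<..<b} - N1 \<Longrightarrow> \<exists>D. ((\<lambda>x. Re (f x)) has_real_derivative D) (at x)"
    using absolutely_continuous_on_differentiable_ae_real[OF 1] by blast
  obtain N2 where N2: "negligible N2"
      "\<And>x. x \<in> {a<..<b} - N2 \<Longrightarrow> \<exists>D. ((\<lambda>x. Im (f x)) has_real_derivative D) (at x)"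
    using absolutely_continuous_on_differentiable_ae_real[OF 2] by blast
  show ?thesis
  proof (rule that[of "N1 \<union> N2"])
    fix x assume "x \<in> {a<..<b} - (N1 \<union> N2)"
    then obtain D1 D2 where "((\<lambda>x. Re (f x)) has_real_derivative D1) (at x)"
      "((\<lambda>x. Im (f x)) has_real_derivative D2) (at x)" using N1 N2 by blast
    then show "\<exists>D. (f has_vector_derivative D) (at x)"
      by (intro exI[of _ "Complex D1 D2"]) (simp add: has_vector_derivative_complex_iff)
  qed (use N1 N2 in auto)
qed

text \<open>A direct gauge-integral argument, which presupposes neither measurability nor
  integrability of \<open>h'\<close>. Where the tag lies off \<open>N\<close>, differentiability
  compares increment and Riemann term; where it lies in \<open>N\<close>, the integrand is reset to
  0 and absolute continuity bounds the increments themselves.\<close>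

lemma absolutely_continuous_on_has_integral:
  assumes ac: "absolutely_continuous_on {a..b} h" and ab: "a \<le> b" and N: "negligible N"
    and h': "\<And>x. x \<in> {a..b} - N \<Longrightarrow> (h has_vector_derivative h' x) (at x)"
  shows "(h' has_integral (h b - h a)) {a..b}"
proof -
  define g where "g = (\<lambda>x. if x \<in> N then 0 else h' x)"
  have "(g has_integral (h b - h a)) {a..b}"
    unfolding has_integral_real
  proof (intro allI impI)
    fix e :: real assume e: "e > 0"
    \<comment> \<open>The \<open>+ 1\<close> keeps the denominator positive when
      \<open>a = b\<close>.\<close>
    define e' where "e' = e / 2 / (b - a + 1)"
    have e': "e' > 0" "e' * (b - a) \<le> e / 2"
      using e ab by (auto simp: e'_def field_simps)
    obtain \<delta> where \<delta>: "\<delta> > 0" and acd: "\<And>D. D division_of \<Union>D \<Longrightarrow> \<Union>D \<subseteq> {a..b} \<Longrightarrow>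
        (\<Sum>J\<in>D. measure lborel J) < \<delta> \<Longrightarrow> (\<Sum>J\<in>D. cmod (h (Sup J) - h (Inf J))) < e / 2"
      using absolutely_continuous_onD[OF ac half_gt_zero[OF e]] by blast
    have N0: "N \<in> null_sets lebesgue" using N by (simp add: negligible_iff_null_sets)
    obtain U where U: "open U" "N \<subseteq> U" "U - N \<in> lmeasurable" "emeasure lebesgue (U - N) < ennreal \<delta>"
      using sets_lebesgue_outer_open[of N \<delta>] N0 \<delta> by (metis null_setsD2)
    have Ueq: "U = (U - N) \<union> N" using U(2) by blast
    have Ul: "U \<in> lmeasurable"
      by (subst Ueq, intro fmeasurable.Un U(3) fmeasurableI_null_sets N0)
    have Um: "measure lebesgue U < \<delta>"
    proof -
      have "measure lebesgue U = measure lebesgue (U - N)"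
        using measure_Un_null_set[OF fmeasurableD[OF U(3)] N0] Ueq by simp
      then show ?thesis using U(3,4) \<delta> by (simp add: emeasure_eq_measure2 ennreal_less_iff)
    qed
    have "\<exists>d>0. \<forall>y. \<bar>y - x\<bar> < d \<longrightarrow> cmod (h y - h x - (y - x) *\<^sub>R h' x) \<le> e' * \<bar>y - x\<bar>"
      if "x \<in> {a..b} - N" for x
      using h'[OF that] e'(1) unfolding has_vector_derivative_def has_derivative_within_alt by auto
    then obtain r where r: "\<And>x. x \<in> {a..b} - N \<Longrightarrow> r x > 0"
      "\<And>x y. x \<in> {a..b} - N \<Longrightarrow> \<bar>y - x\<bar> < r x \<Longrightarrow> cmod (h y - h x - (y - x) *\<^sub>R h' x) \<le> e' * \<bar>y - x\<bar>"
      by metis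
    \<comment> \<open>Intervals tagged in \<open>N\<close> are confined to the open set
      \<open>U\<close> of measure below \<open>\<delta>\<close>, the others to the radius where
      \<open>h\<close> is linear up to \<open>e'\<close>.\<close>
    define \<gamma> where "\<gamma> = (\<lambda>x. if x \<in> N then U else if x \<in> {a..b} then ball x (r x) else UNIV)"
    have "gauge \<gamma>" using U r(1) by (auto simp: gauge_def \<gamma>_def)
    moreover have "norm ((\<Sum>(x,K)\<in>p. measure lborel K *\<^sub>R g x) - (h b - h a)) < e"
      if p: "p tagged_division_of {a..b}" and fine: "\<gamma> fine p" for p
    proof -
      define \<phi> where "\<phi> = (\<lambda>(x,K). measure lborel K *\<^sub>R g x - (h (Sup K) - h (Inf K)))"
      have fp: "finite p" using p by auto
      define pN where "pN = {z\<in>p. fst z \<in> N}"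
      have K: "\<exists>u v. u \<le> x \<and> x \<le> v \<and> K = {u..v} \<and> {u..v} \<subseteq> {a..b}" if "(x,K) \<in> p" for x K
        using tagged_division_ofD(2,3,4)[OF p that] by (metis atLeastAtMost_iff box_real(2))
      have good: "norm (\<phi> z) \<le> e' * (case z of (x,K) \<Rightarrow> Sup K - Inf K)" if z: "z \<in> p - pN" for z
      proof -
        obtain x K where z': "z = (x,K)" by (cases z)
        with z have x: "x \<notin> N" "(x,K) \<in> p" by (auto simp: pN_def)
        obtain u v where uv: "u \<le> x" "x \<le> v" "K = {u..v}" "{u..v} \<subseteq> {a..b}" using K[OF x(2)] by auto
        have xab: "x \<in> {a..b} - N" using uv x by (auto simp: subset_iff)
        have "K \<subseteq> \<gamma> x" using fine x(2) by (auto simp: fine_def)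
        then have "K \<subseteq> ball x (r x)" using xab by (simp add: \<gamma>_def)
        moreover have "u \<in> K" "v \<in> K" using uv by auto
        ultimately have "u \<in> ball x (r x)" "v \<in> ball x (r x)" by blast+
        then have "\<bar>u - x\<bar> < r x" "\<bar>v - x\<bar> < r x" by (auto simp: dist_real_def abs_minus_commute)
        then have 1: "cmod (h v - h x - (v - x) *\<^sub>R h' x) \<le> e' * (v - x)"
          and 2: "cmod (h u - h x - (u - x) *\<^sub>R h' x) \<le> e' * (x - u)"
          using r(2)[OF xab, of u] r(2)[OF xab, of v] uv by auto
        \<comment> \<open>Straddle estimate: the tag lies between \<open>u\<close> and
          \<open>v\<close>, so the two linearization errors add up to at most
          \<open>e' * (v - u)\<close>.\<close>
        have "\<phi> z = (h u - h x - (u - x) *\<^sub>R h' x) - (h v - h x - (v - x) *\<^sub>R h' x)"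
          using uv x by (simp add: z' \<phi>_def g_def algebra_simps)
        then have "norm (\<phi> z) \<le> e' * (x - u) + e' * (v - x)"
          using norm_triangle_ineq4 1 2 by (smt (verit))
        then show ?thesis using uv by (simp add: z' algebra_simps)
      qed
      have "norm (sum \<phi> (p - pN)) \<le> (\<Sum>z\<in>p - pN. e' * (case z of (x,K) \<Rightarrow> Sup K - Inf K))"
        by (rule sum_norm_le[OF good])
      also have "\<dots> \<le> (\<Sum>z\<in>p. e' * (case z of (x,K) \<Rightarrow> Sup K - Inf K))"
        using fp K e'(1) by (intro sum_mono2) (fastforce intro!: mult_nonneg_nonneg)+
      also have "\<dots> = e' * (\<Sum>(x,K)\<in>p. Sup K - Inf K)"
        by (simp add: sum_distrib_left)
      also have "(\<Sum>(x,K)\<in>p. Sup K - Inf K) = b - a"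
        using additive_tagged_division_1[OF ab p, of "\<lambda>x. x"] by simp
      finally have b1: "norm (sum \<phi> (p - pN)) \<le> e / 2" using e' by simp
      have part: "pN tagged_partial_division_of {a..b}"
        using tagged_partial_division_subset[of p "{a..b}" pN] p
        by (auto simp: pN_def tagged_division_of_def)
      have div: "snd ` pN division_of \<Union>(snd ` pN)"
        by (rule partial_division_of_tagged_division[OF part])
      \<comment> \<open>An interval carrying two tags has empty interior, hence is a point, and the
        tags agree. The sum over tagged pairs is therefore a sum over intervals, as absolute
        continuity needs.\<close>
      have inj: "inj_on snd pN"
      proof (rule inj_onI)
        fix z z' assume z: "z \<in> pN" "z' \<in> pN" "snd z = snd z'"
        obtain x K x' where zz: "z = (x,K)" "z' = (x',K)" using z by (metis prod.collapse)
        show "z = z'"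
        proof (rule ccontr)
          assume "z \<noteq> z'"
          then have "interior K = {}"
            using tagged_partial_division_ofD(5)[OF part] z zz by blast
          moreover obtain u v where "K = {u..v}" "u \<le> x" "x \<le> v" using K[of x K] z zz by (auto simp: pN_def)
          moreover have "x' \<in> K" using K[of x' K] z zz by (auto simp: pN_def)
          ultimately have "x = x'" by (auto simp: interior_atLeastAtMost_real)
          then show False using \<open>z \<noteq> z'\<close> zz by simp
        qed
      qed
      have "K \<subseteq> U" if "(x, K) \<in> pN" for x K
      proof -
        have "x \<in> N" "K \<subseteq> \<gamma> x" using that fine by (auto simp: pN_def fine_def)
        then show ?thesis by (simp add: \<gamma>_def)
      qed
      then have "\<Union>(snd ` pN) \<subseteq> U" by force
      then have "measure lebesgue (\<Union>(snd ` pN)) \<le> measure lebesgue U"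
        using measure_division[OF div] Ul by (intro measure_mono_fmeasurable) (auto simp: fmeasurableD)
      then have "(\<Sum>J\<in>snd ` pN. measure lborel J) < \<delta>"
        using measure_division[OF div] Um by simp
      moreover have "\<Union>(snd ` pN) \<subseteq> {a..b}"
        using K by (fastforce simp: pN_def)
      ultimately have "(\<Sum>J\<in>snd ` pN. cmod (h (Sup J) - h (Inf J))) < e / 2"
        using acd[OF div] by simp
      then have "(\<Sum>z\<in>pN. cmod (h (Sup (snd z)) - h (Inf (snd z)))) < e / 2"
        by (simp add: sum.reindex[OF inj] o_def)
      moreover have "norm (sum \<phi> pN) \<le> (\<Sum>z\<in>pN. cmod (h (Sup (snd z)) - h (Inf (snd z))))"
        by (rule sum_norm_le) (auto simp: pN_def \<phi>_def g_def norm_minus_commute)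
      ultimately have b2: "norm (sum \<phi> pN) < e / 2" by simp
      have "(\<Sum>(x,K)\<in>p. measure lborel K *\<^sub>R g x) - (h b - h a) = sum \<phi> p"
        using additive_tagged_division_1[OF ab p, of h]
        by (simp add: \<phi>_def split_def sum_subtractf)
      also have "\<dots> = sum \<phi> (p - pN) + sum \<phi> pN"
        by (rule sum.subset_diff) (auto simp: pN_def fp)
      finally have eq: "(\<Sum>(x,K)\<in>p. measure lborel K *\<^sub>R g x) - (h b - h a) = sum \<phi> (p - pN) + sum \<phi> pN" .
      show ?thesis
        unfolding eq using b1 b2 norm_triangle_ineq[of "sum \<phi> (p - pN)" "sum \<phi> pN"] by linarith
    qed
    ultimately show "\<exists>\<gamma>. gauge \<gamma> \<and> (\<forall>p. p tagged_division_of {a..b} \<and> \<gamma> fine p \<longrightarrow>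
        norm ((\<Sum>(x,K)\<in>p. measure lborel K *\<^sub>R g x) - (h b - h a)) < e)"
      by (intro exI[of _ \<gamma>] conjI allI impI) auto
  qed
  moreover have "h' x = g x" if "x \<in> {a..b} - N" for x
    using that by (simp add: g_def)
  ultimately show ?thesis
    using has_integral_spike[OF N, of "{a..b}" h' g] by blast
qed

subsection \<open>Interpolation at separated points\<close>

lemma poly_antiderivative:
  fixes P :: "complex poly"
  obtains Q where "pderiv Q = P" "degree Q \<le> Suc (degree P)"
proof
  let ?Q = "\<Sum>i\<le>degree P. monom (coeff P i / of_nat (Suc i)) (Suc i)"
  have "pderiv ?Q = (\<Sum>i\<le>degree P. monom (coeff P i) i)"
    by (simp add: higher_pderiv_sum[of 1, simplified] pderiv_monom del: of_nat_Suc)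
  then show "pderiv ?Q = P" by (simp add: poly_as_sum_of_monoms)
  show "degree ?Q \<le> Suc (degree P)"
    by (intro degree_sum_le) (auto intro: order_trans[OF degree_monom_le])
qed

text \<open>Taylor approximation without a derivative of order \<open>n + 1\<close>: only the
  oscillation of \<open>f n\<close> about \<open>c\<close> enters. Each induction step integrates
  the polynomial found for \<open>f 1\<close>, fixes the constant by agreement with
  \<open>f 0\<close> at \<open>c\<close>, and gains a factor \<open>b - a\<close> from the mean
  value inequality.\<close>

lemma polynomial_approximation:
  fixes f :: "nat \<Rightarrow> real \<Rightarrow> complex"
  assumes "c \<in> {a..b}"
    and "\<And>k x. k < n \<Longrightarrow> x \<in> {a..b} \<Longrightarrow> (f k has_vector_derivative f (Suc k) x) (at x within {a..b})"
    and "\<And>x. x \<in> {a..b} \<Longrightarrow> cmod (f n x - f n c) \<le> M"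
  shows "\<exists>T. degree T \<le> n \<and> (\<forall>x\<in>{a..b}. cmod (f 0 x - poly T (of_real x)) \<le> M * (b - a) ^ n)"
  using assms(2,3)
proof (induction n arbitrary: f)
  case 0
  show ?case
    by (rule exI[of _ "[:f 0 c:]"]) (use 0(2) in auto)
next
  case (Suc n)
  have "\<exists>T. degree T \<le> n \<and> (\<forall>x\<in>{a..b}. cmod (f (Suc 0) x - poly T (of_real x)) \<le> M * (b - a) ^ n)"
    using Suc.IH[of "\<lambda>k. f (Suc k)"] Suc.prems by auto
  then obtain T1 where T1: "degree T1 \<le> n"
    "\<And>x. x \<in> {a..b} \<Longrightarrow> cmod (f (Suc 0) x - poly T1 (of_real x)) \<le> M * (b - a) ^ n" by blast
  obtain Q where Q: "pderiv Q = T1" "degree Q \<le> Suc (degree T1)" by (rule poly_antiderivative)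
  define T where "T = Q + [:f 0 c - poly Q (of_real c):]"
  define u where "u = (\<lambda>x. f 0 x - poly T (of_real x))"
  have pT: "pderiv T = T1" by (simp add: T_def pderiv_add Q pderiv_pCons)
  have du: "(u has_vector_derivative f (Suc 0) x - poly T1 (of_real x)) (at x within {a..b})"
    if "x \<in> {a..b}" for x
    unfolding u_def
  proof (rule has_vector_derivative_diff)
    show "(f 0 has_vector_derivative f (Suc 0) x) (at x within {a..b})" using Suc.prems that by auto
    have "(poly T has_field_derivative poly T1 (of_real x)) (at (of_real x))"
      using poly_DERIV[of T "of_real x"] by (simp add: pT)
    then show "((\<lambda>x. poly T (of_real x)) has_vector_derivative poly T1 (of_real x)) (at x within {a..b})"
      by (intro has_vector_derivative_real_field)
  qed
  have uc: "u c = 0" by (simp add: u_def T_def)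
  have B0: "M * (b - a) ^ n \<ge> 0" using T1(2)[OF assms(1)] norm_ge_zero order_trans by blast
  have "cmod (u x) \<le> M * (b - a) ^ Suc n" if x: "x \<in> {a..b}" for x
  proof -
    have "norm (u x - u c) \<le> M * (b - a) ^ n * norm (x - c)"
    proof (rule differentiable_bound[of "{a..b}"])
      fix y assume y: "y \<in> {a..b}"
      show "(u has_derivative (\<lambda>h. h *\<^sub>R (f (Suc 0) y - poly T1 (of_real y)))) (at y within {a..b})"
        using du[OF y] by (simp add: has_vector_derivative_def)
      show "onorm (\<lambda>h. h *\<^sub>R (f (Suc 0) y - poly T1 (of_real y))) \<le> M * (b - a) ^ n"
        using T1(2)[OF y] by (intro onorm_le) (simp add: mult.commute mult_left_mono)
    qed (use x assms(1) in auto)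
    also have "\<dots> \<le> M * (b - a) ^ n * (b - a)"
      using x assms(1) B0 by (intro mult_left_mono) auto
    finally show ?thesis using uc by (simp add: algebra_simps)
  qed
  moreover have "degree T \<le> Suc n"
    using Q(2) T1(1) unfolding T_def by (intro degree_add_le) auto
  ultimately show ?case unfolding u_def by blast
qed

text \<open>\<open>T\<close> coincides with its Lagrange interpolant \<open>q\<close> at the
  \<open>r\<close> points. Each basis polynomial has \<open>r - 1\<close> factors, all bounded by
  \<open>L / K\<close> at \<open>z\<close>.\<close>

lemma poly_norm_le_values:
  fixes T :: "complex poly" and x :: "nat \<Rightarrow> complex"
  assumes deg: "degree T < r" and K: "K > 0"
    and sep: "\<And>i j. i < r \<Longrightarrow> j < r \<Longrightarrow> i \<noteq> j \<Longrightarrow> cmod (x i - x j) \<ge> K"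
    and z: "\<And>j. j < r \<Longrightarrow> cmod (z - x j) \<le> L"
  shows "cmod (poly T z) \<le> (L / K) ^ (r - 1) * (\<Sum>i<r. cmod (poly T (x i)))"
proof -
  define den where "den = (\<lambda>i. \<Prod>j\<in>{..<r} - {i}. x i - x j)"
  define q where "q = (\<Sum>i<r. smult (poly T (x i) / den i) (\<Prod>j\<in>{..<r} - {i}. [:- x j, 1:]))"
  have pq: "poly q w = (\<Sum>i<r. poly T (x i) * (\<Prod>j\<in>{..<r} - {i}. (w - x j) / (x i - x j)))" for w
    by (simp add: q_def poly_sum poly_prod den_def prod_dividef)
  have ne: "x i \<noteq> x j" if "i < r" "j < r" "i \<noteq> j" for i j
    using sep[OF that] K by auto
  have inj: "inj_on x {..<r}" using ne by (auto simp: inj_on_def)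
  have "poly q (x k) = poly T (x k)" if k: "k < r" for k
  proof -
    have "(\<Prod>j\<in>{..<r} - {i}. (x k - x j) / (x i - x j)) = (if i = k then 1 else 0)" if i: "i < r" for i
    proof (cases "i = k")
      case True
      then show ?thesis using ne i by (auto intro!: prod.neutral)
    next
      case False
      then have "k \<in> {..<r} - {i}" using k by auto
      then show ?thesis using False by (auto intro!: prod_zero bexI[of _ k])
    qed
    then have "poly q (x k) = (\<Sum>i<r. poly T (x i) * (if i = k then 1 else 0))"
      unfolding pq by (intro sum.cong) auto
    also have "\<dots> = poly T (x k)" using k by (simp add: if_distrib cong: if_cong)
    finally show ?thesis .
  qed
  moreover have "degree q < card (x ` {..<r})"
  proof -
    have "degree (\<Prod>j\<in>{..<r} - {i}. [:- x j, 1:]) \<le> r - 1" if "i < r" for i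
    proof -
      have "degree (\<Prod>j\<in>{..<r} - {i}. [:- x j, 1:]) \<le> (\<Sum>j\<in>{..<r} - {i}. degree [:- x j, 1:])"
        by (rule degree_prod_sum_le[unfolded o_def]) simp
      also have "\<dots> = r - 1" using that by simp
      finally show ?thesis .
    qed
    then have "degree q \<le> r - 1" unfolding q_def
      by (intro degree_sum_le) (auto intro: order_trans[OF degree_smult_le])
    then show ?thesis using deg by (simp add: card_image[OF inj])
  qed
  moreover have "degree T < card (x ` {..<r})" using deg by (simp add: card_image[OF inj])
  ultimately have qT: "q = T"
    by (intro poly_eqI_degree[of "x ` {..<r}"]) auto
  have L: "L \<ge> 0" using z[of 0] deg norm_ge_zero order_trans by (metis gr0I not_less_zero)
  have bd: "cmod (\<Prod>j\<in>{..<r} - {i}. (z - x j) / (x i - x j)) \<le> (L / K) ^ (r - 1)" if i: "i < r" for i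
  proof -
    have "cmod (\<Prod>j\<in>{..<r} - {i}. (z - x j) / (x i - x j)) = (\<Prod>j\<in>{..<r} - {i}. cmod (z - x j) / cmod (x i - x j))"
      by (simp add: prod_norm[symmetric] norm_divide)
    also have "\<dots> \<le> (\<Prod>j\<in>{..<r} - {i}. L / K)"
      using sep z i K L by (intro prod_mono) (auto intro!: frac_le)
    also have "\<dots> = (L / K) ^ (r - 1)" using i by simp
    finally show ?thesis .
  qed
  have "cmod (poly T z) \<le> (\<Sum>i<r. cmod (poly T (x i) * (\<Prod>j\<in>{..<r} - {i}. (z - x j) / (x i - x j))))"
    unfolding pq[of z, unfolded qT] by (rule norm_sum)
  also have "\<dots> \<le> (\<Sum>i<r. cmod (poly T (x i)) * (L / K) ^ (r - 1))"
    using bd by (intro sum_mono) (auto simp: norm_mult intro!: mult_left_mono)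
  finally show ?thesis by (simp add: sum_distrib_left mult.commute)
qed

text \<open>A polynomial of degree below \<open>r\<close> is within \<open>M * L ^ (r - 1)\<close>
  of \<open>f 0\<close> on the whole interval. This error is paid \<open>r\<close> times in passing
  to the values at the sample points and once more in returning to \<open>f 0\<close> at
  \<open>t\<close>, whence the factor \<open>1 + r\<close>.\<close>

lemma norm_le_samples:
  fixes f :: "nat \<Rightarrow> real \<Rightarrow> complex" and x :: "nat \<Rightarrow> real"
  assumes r: "r \<ge> 1" and K: "K > 0" and L: "b - a \<le> L" "K \<le> L"
    and f: "\<And>k t. k < r - 1 \<Longrightarrow> t \<in> {a..b} \<Longrightarrow> (f k has_vector_derivative f (Suc k) t) (at t within {a..b})"
    and M: "\<And>s t. s \<in> {a..b} \<Longrightarrow> t \<in> {a..b} \<Longrightarrow> cmod (f (r - 1) t - f (r - 1) s) \<le> M"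
    and x: "\<And>i. i < r \<Longrightarrow> x i \<in> {a..b}"
    and sep: "\<And>i j. i < j \<Longrightarrow> j < r \<Longrightarrow> x j - x i \<ge> K"
    and t: "t \<in> {a..b}"
  shows "cmod (f 0 t) \<le> (L / K) ^ (r - 1) * (1 + (1 + real r) * L ^ (r - 1)) * ((\<Sum>i<r. cmod (f 0 (x i))) + M)"
proof -
  define Y where "Y = (L / K) ^ (r - 1)"
  define Z where "Z = L ^ (r - 1)"
  define S where "S = (\<Sum>i<r. cmod (f 0 (x i)))"
  have Y: "Y \<ge> 1" unfolding Y_def using K L by (intro one_le_power) simp
  have Z: "Z \<ge> 0" using K L by (simp add: Z_def)
  have S: "S \<ge> 0" by (simp add: S_def sum_nonneg)
  have M0: "M \<ge> 0" using M[OF t t] by simp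
  obtain T where T: "degree T \<le> r - 1"
    "\<And>s. s \<in> {a..b} \<Longrightarrow> cmod (f 0 s - poly T (of_real s)) \<le> M * (b - a) ^ (r - 1)"
    using polynomial_approximation[OF t, of "r - 1" f M] f M t by blast
  have ab: "a \<le> b" using t by simp
  have T': "cmod (f 0 s - poly T (of_real s)) \<le> M * Z" if "s \<in> {a..b}" for s
  proof -
    have "M * (b - a) ^ (r - 1) \<le> M * Z" unfolding Z_def
      using ab L M0 by (intro mult_left_mono power_mono) auto
    then show ?thesis using T(2)[OF that] by simp
  qed
  have "cmod (poly T (of_real t)) \<le> (L / K) ^ (r - 1) * (\<Sum>i<r. cmod (poly T (complex_of_real (x i))))"
  proof (rule poly_norm_le_values)
    fix i j assume "i < r" "j < r" "i \<noteq> j"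
    then have "\<bar>x i - x j\<bar> \<ge> K" using sep[of i j] sep[of j i] by linarith
    then show "K \<le> cmod (complex_of_real (x i) - complex_of_real (x j))"
      by (metis norm_of_real of_real_diff real_norm_def)
  next
    fix j assume "j < r"
    then have "\<bar>t - x j\<bar> \<le> L" using x[of j] t L by auto
    then show "cmod (complex_of_real t - complex_of_real (x j)) \<le> L"
      by (metis norm_of_real of_real_diff real_norm_def)
  qed (use T(1) r K in auto)
  also have "\<dots> \<le> Y * (\<Sum>i<r. cmod (f 0 (x i)) + M * Z)"
    unfolding Y_def
  proof (intro mult_left_mono sum_mono)
    fix i assume "i \<in> {..<r}"
    then show "cmod (poly T (complex_of_real (x i))) \<le> cmod (f 0 (x i)) + M * Z"
      using T'[of "x i"] x[of i] norm_triangle_ineq2[of "poly T (complex_of_real (x i))" "f 0 (x i)"]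
      by (simp add: norm_minus_commute)
  qed (use K L in auto)
  also have "\<dots> = Y * (S + r * (M * Z))" by (simp add: S_def sum.distrib)
  finally have "cmod (f 0 t) \<le> Y * (S + r * (M * Z)) + M * Z"
    using T'[OF t] norm_triangle_ineq2[of "f 0 t" "poly T (of_real t)"] by simp
  \<comment> \<open>\<open>Y >= 1\<close>, which rests on \<open>K <= L\<close>, absorbs the
    approximation error at \<open>t\<close> into the common factor.\<close>
  also have "\<dots> \<le> Y * (S + r * (M * Z)) + Y * (M * Z)"
    using mult_right_mono[OF Y, of "M * Z"] M0 Z by simp
  also have "\<dots> = Y * S + Y * ((1 + r) * Z) * M" by (simp add: algebra_simps)
  also have "\<dots> \<le> Y * (1 + (1 + r) * Z) * S + Y * (1 + (1 + r) * Z) * M"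
    using Y Z S M0 by (intro add_mono mult_right_mono) (auto simp: algebra_simps)
  finally show ?thesis unfolding Y_def Z_def S_def by (simp add: algebra_simps)
qed

text \<open>Since \<open>I\<close> is open, the derivative within \<open>I\<close> is the two-sided
  one; the endpoints \<open>a\<close> and \<open>b\<close> join the exceptional null set.\<close>

lemma absolutely_continuous_on_vector_derivative:
  assumes ac: "absolutely_continuous_on {a..b} h" and ab: "a \<le> b" and I: "open I" "{a..b} \<subseteq> I"
  shows "((\<lambda>x. vector_derivative h (at x within I)) has_integral (h b - h a)) {a..b}"
proof -
  obtain N where N: "negligible N" "\<And>x. x \<in> {a<..<b} - N \<Longrightarrow> \<exists>D. (h has_vector_derivative D) (at x)"
    by (rule absolutely_continuous_on_differentiable_ae[OF ac]) blast
  show ?thesis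
  proof (rule absolutely_continuous_on_has_integral[OF ac ab])
    show "negligible (N \<union> {a, b})" using N(1) by auto
    fix x assume x: "x \<in> {a..b} - (N \<union> {a, b})"
    then have "\<exists>D. (h has_vector_derivative D) (at x)" using N(2)[of x] by auto
    moreover have "at x within I = at x" using x I by (intro at_within_open) auto
    ultimately show "(h has_vector_derivative vector_derivative h (at x within I)) (at x)"
      by (metis vector_derivative_works differentiableI_vector)
  qed
qed

text \<open>The gauge integral may exist without absolute integrability. The bound is trivial if the
  right side is infinite; otherwise \<open>g\<close> is Lebesgue integrable and the two integrals
  agree.\<close>

lemma has_integral_norm_le_nn_integral:
  fixes g :: "real \<Rightarrow> complex"
  assumes "(g has_integral c) {a..b}"
  shows "ennreal (cmod c) \<le> (\<integral>\<^sup>+x\<in>{a..b}. ennreal (cmod (g x)) \<partial>lebesgue)"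
proof -
  have m: "g \<in> borel_measurable (lebesgue_on {a..b})"
    using assms by (intro integrable_imp_measurable has_integral_integrable)
  have eq: "(\<integral>\<^sup>+x. ennreal (cmod (g x)) \<partial>lebesgue_on {a..b}) = (\<integral>\<^sup>+x\<in>{a..b}. ennreal (cmod (g x)) \<partial>lebesgue)"
    by (rule nn_integral_restrict_space) simp
  show ?thesis
  proof (cases "(\<integral>\<^sup>+x\<in>{a..b}. ennreal (cmod (g x)) \<partial>lebesgue) = \<infinity>")
    case False
    then have "integrable (lebesgue_on {a..b}) g"
      using m eq by (intro integrableI_bounded) (auto simp: less_top)
    moreover from this have "integral\<^sup>L (lebesgue_on {a..b}) g = c"
      using assms by (simp add: lebesgue_integral_eq_integral integral_unique)
    ultimately show ?thesis using integral_norm_bound_ennreal eq by metis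
  qed simp
qed

section \<open>Sobolev functions: control by sample values and the top derivative\<close>

context
  fixes r :: nat and I :: "real set" and F :: "real \<Rightarrow> complex"
  assumes r: "r \<ge> 1" and I: "open I" and reg: "sobolev_regular r I F"
begin

lemma nth_derivative_has_vector_derivative:
  assumes "k < r - 1" "t \<in> I"
  shows "(nth_derivative I k F has_vector_derivative nth_derivative I (Suc k) F t) (at t within S)"
proof -
  have "nth_derivative I k F differentiable (at t within I)"
    using reg assms by (auto simp: sobolev_regular_def)
  then have "(nth_derivative I k F has_vector_derivative nth_derivative I (Suc k) F t) (at t within I)"
    by (simp add: vector_derivative_works)
  then have "(nth_derivative I k F has_vector_derivative nth_derivative I (Suc k) F t) (at t)"
    using at_within_open[OF assms(2) I] by metis
  then show ?thesis by (rule has_vector_derivative_at_within)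
qed

lemma top_derivative_has_integral:
  assumes "a \<le> b" "{a..b} \<subseteq> I"
  shows "(nth_derivative I r F has_integral
    (nth_derivative I (r - 1) F b - nth_derivative I (r - 1) F a)) {a..b}"
proof -
  have "absolutely_continuous_on {a..b} (nth_derivative I (r - 1) F)"
    using reg assms by (auto simp: sobolev_regular_def locally_absolutely_continuous_on_def)
  from absolutely_continuous_on_vector_derivative[OF this assms(1) I assms(2)]
  show ?thesis using r by (cases r) auto
qed

text \<open>Measurability is not part of \<open>sobolev_regular\<close>; it comes from gauge
  integrability of the top derivative.\<close>

lemma top_derivative_measurable:
  assumes "{a..b} \<subseteq> I"
  shows "nth_derivative I r F \<in> borel_measurable (lebesgue_on {a..b})"
proof (cases "a \<le> b")
  case True
  then show ?thesis
    by (intro integrable_imp_measurable has_integral_integrable[OF top_derivative_has_integral] assms)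
next
  case False
  then show ?thesis by (intro measurableI) (auto simp: space_restrict_space)
qed

lemma continuous_on_sobolev_regular: "continuous_on I F"
  using reg r by (auto simp: sobolev_regular_def dest: spec[of _ 0])

text \<open>The integral of \<open>|F^(r)|\<close> bounds the oscillation of \<open>F^(r-1)\<close>,
  which is the form in which \<open>norm_le_samples\<close> takes its information on the last
  derivative.\<close>

lemma sobolev_norm_le_samples:
  assumes K: "K > 0" and L: "b - a \<le> L" "K \<le> L" and ab: "{a..b} \<subseteq> I"
    and x: "\<And>i. i < r \<Longrightarrow> x i \<in> {a..b}"
    and sep: "\<And>i j. i < j \<Longrightarrow> j < r \<Longrightarrow> x j - x i \<ge> K"
    and t: "t \<in> {a..b}"
    and M: "(\<integral>\<^sup>+x\<in>{a..b}. ennreal (cmod (nth_derivative I r F x)) \<partial>lebesgue) \<le> ennreal M" "M \<ge> 0"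
  shows "cmod (F t) \<le> (L / K) ^ (r - 1) * (1 + (1 + real r) * L ^ (r - 1)) * ((\<Sum>i<r. cmod (F (x i))) + M)"
proof -
  let ?f = "\<lambda>k. nth_derivative I k F"
  have le: "cmod (?f (r - 1) v - ?f (r - 1) u) \<le> M" if "u \<in> {a..b}" "v \<in> {a..b}" "u \<le> v" for u v
  proof -
    have sub: "{u..v} \<subseteq> I" using that ab by auto
    have "ennreal (cmod (?f (r - 1) v - ?f (r - 1) u)) \<le> (\<integral>\<^sup>+x\<in>{u..v}. ennreal (cmod (?f r x)) \<partial>lebesgue)"
      by (rule has_integral_norm_le_nn_integral[OF top_derivative_has_integral[OF that(3) sub]])
    also have "\<dots> \<le> (\<integral>\<^sup>+x\<in>{a..b}. ennreal (cmod (?f r x)) \<partial>lebesgue)"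
      using that by (intro nn_integral_mono) (auto simp: indicator_def)
    also have "\<dots> \<le> ennreal M" by fact
    finally show ?thesis using M(2) by simp
  qed
  have "cmod (?f 0 t) \<le> (L / K) ^ (r - 1) * (1 + (1 + real r) * L ^ (r - 1)) * ((\<Sum>i<r. cmod (?f 0 (x i))) + M)"
  proof (rule norm_le_samples[where f = ?f and a = a and b = b and t = t, OF r K L])
    show "cmod (?f (r - 1) v - ?f (r - 1) u) \<le> M" if "u \<in> {a..b}" "v \<in> {a..b}" for u v
      using le[of u v] le[of v u] that by (cases "u \<le> v") (auto simp: norm_minus_commute)
    show "(?f k has_vector_derivative ?f (Suc k) t) (at t within {a..b})" if "k < r - 1" "t \<in> {a..b}" for k t
      using nth_derivative_has_vector_derivative that ab by blast
  qed (use x sep t in auto)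
  then show ?thesis by simp
qed

end

section \<open>From integrals of the modulus to p-th powers\<close>

lemma le_add_powr_mult:
  fixes t s p :: real
  assumes "t \<ge> 0" "s > 0" "p \<ge> 1"
  shows "t \<le> s + t powr p * s powr (1 - p)"
proof (cases "t \<le> s")
  case True
  then show ?thesis by (simp add: add_increasing2)
next
  case False
  \<comment> \<open>The exponent \<open>1 - p\<close> is at most 0, so replacing \<open>t\<close> by
    the smaller \<open>s\<close> in the second factor increases it. This splitting stands in for
    Hoelder's inequality.\<close>
  then have "t = t powr p * t powr (1 - p)"
    using assms by (simp flip: powr_add)
  also have "\<dots> \<le> t powr p * s powr (1 - p)"
    using False assms by (intro mult_left_mono powr_mono2') auto
  finally show ?thesis using assms by linarith
qed

text \<open>Integrating the splitting at threshold \<open>s\<close> gives \<open>(b - a) * s\<close>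
  from small values and \<open>s powr p * s powr (1 - p) = s\<close> from large ones, so the factor
  \<open>b - a + 1\<close> is free of \<open>p\<close>.\<close>

lemma nn_integral_le_of_powr:
  fixes g :: "real \<Rightarrow> complex"
  assumes m: "g \<in> borel_measurable (lebesgue_on {a..b})" and ab: "a \<le> b" and p: "p \<ge> 1" and s: "s > 0"
    and P: "(\<integral>\<^sup>+x\<in>{a..b}. ennreal (cmod (g x) powr p) \<partial>lebesgue) \<le> ennreal (s powr p)"
  shows "(\<integral>\<^sup>+x\<in>{a..b}. ennreal (cmod (g x)) \<partial>lebesgue) \<le> ennreal ((b - a + 1) * s)"
proof -
  let ?M = "lebesgue_on {a..b}"
  have eq: "(\<integral>\<^sup>+x. h x \<partial>?M) = (\<integral>\<^sup>+x\<in>{a..b}. h x \<partial>lebesgue)" for h :: "real \<Rightarrow> ennreal"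
    by (rule nn_integral_restrict_space) simp
  have "(\<integral>\<^sup>+x. ennreal (cmod (g x)) \<partial>?M) \<le> (\<integral>\<^sup>+x. ennreal s + ennreal (cmod (g x) powr p) * ennreal (s powr (1 - p)) \<partial>?M)"
  proof (intro nn_integral_mono)
    fix x
    have "ennreal (cmod (g x)) \<le> ennreal (s + cmod (g x) powr p * s powr (1 - p))"
      using le_add_powr_mult[of "cmod (g x)" s p] s p by (intro ennreal_leI) auto
    also have "\<dots> = ennreal s + ennreal (cmod (g x) powr p) * ennreal (s powr (1 - p))"
      using s by (simp add: ennreal_plus ennreal_mult)
    finally show "ennreal (cmod (g x)) \<le> \<dots>" .
  qed
  also have "\<dots> = ennreal s * emeasure ?M (space ?M) + (\<integral>\<^sup>+x. ennreal (cmod (g x) powr p) \<partial>?M) * ennreal (s powr (1 - p))"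
    using m by (subst nn_integral_add) (auto simp: nn_integral_multc)
  also have "emeasure ?M (space ?M) = ennreal (b - a)"
    using ab by (simp add: emeasure_restrict_space space_restrict_space)
  also have "(\<integral>\<^sup>+x. ennreal (cmod (g x) powr p) \<partial>?M) * ennreal (s powr (1 - p)) \<le> ennreal (s powr p) * ennreal (s powr (1 - p))"
    using P unfolding eq by (intro mult_right_mono) auto
  also have "ennreal (s powr p) * ennreal (s powr (1 - p)) = ennreal s"
    using s by (simp flip: ennreal_mult powr_add)
  also have "ennreal s * ennreal (b - a) + ennreal s = ennreal ((b - a + 1) * s)"
    using s ab by (simp flip: ennreal_mult ennreal_plus add: algebra_simps)
  finally show ?thesis by (simp add: eq add_left_mono)
qed

text \<open>All summands are compared with the largest of \<open>s\<close> and the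
  \<open>u i\<close>, whose p-th power is one of the terms on the right. This way the only
  dependence on \<open>p\<close> is that of a fixed constant raised to the power
  \<open>p\<close>.\<close>

lemma powr_sum_le:
  fixes u :: "nat \<Rightarrow> real"
  assumes u: "\<And>i. i < r \<Longrightarrow> u i \<ge> 0" and s: "s \<ge> 0" and L: "L \<ge> 0" and p: "p > 0" and C: "C \<ge> 0"
    and y: "0 \<le> y" "y \<le> C * ((\<Sum>i<r. u i) + (L + 1) * s)"
  shows "y powr p \<le> (C * ((L + 1) * (real r + 1))) powr p * ((\<Sum>i<r. u i powr p) + s powr p)"
proof -
  define m where "m = Max (insert s (u ` {..<r}))"
  have mu: "u i \<le> m" if "i < r" for i using that by (simp add: m_def)
  have ms: "s \<le> m" by (simp add: m_def)
  have "(\<Sum>i<r. u i) \<le> (\<Sum>i<r. m)" by (intro sum_mono mu) simp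
  moreover have "(L + 1) * s \<le> (L + 1) * m" using ms L by (intro mult_left_mono) auto
  moreover have "0 \<le> L * (r * m)" using L ms s by simp
  ultimately have "(\<Sum>i<r. u i) + (L + 1) * s \<le> (L + 1) * (real r + 1) * m"
    by (simp add: algebra_simps)
  then have "y \<le> C * ((L + 1) * (real r + 1) * m)"
    using y C by (meson mult_left_mono order_trans)
  then have "y powr p \<le> (C * ((L + 1) * (real r + 1)) * m) powr p"
    using y p by (intro powr_mono2) (auto simp: mult.assoc)
  also have "\<dots> = (C * ((L + 1) * (real r + 1))) powr p * m powr p"
    by (rule powr_mult)
  also have "m powr p \<le> (\<Sum>i<r. u i powr p) + s powr p"
  proof -
    have "m \<in> insert s (u ` {..<r})" unfolding m_def by (intro Max_in) auto
    then consider "m = s" | i where "i < r" "m = u i" by auto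
    then show ?thesis
    proof cases
      case 1
      then show ?thesis by (simp add: sum_nonneg)
    next
      case 2
      then have "m powr p \<le> (\<Sum>i<r. u i powr p)"
        using member_le_sum[of i "{..<r}" "\<lambda>i. u i powr p"] by auto
      then show ?thesis by (simp add: add_increasing2)
    qed
  qed
  finally show ?thesis by (simp add: mult_left_mono)
qed

text \<open>All constants below are of the form \<open>c powr p\<close> with \<open>c\<close> independent of \<open>p\<close>, so that after
  taking \<open>p\<close>-th roots the bounds are uniform in \<open>p\<close>.\<close>

definition sample_const :: "nat \<Rightarrow> real \<Rightarrow> real \<Rightarrow> real" where
  "sample_const r K L = (L / K) ^ (r - 1) * (1 + (1 + real r) * L ^ (r - 1)) * ((L + 1) * (real r + 1))"

lemma sobolev_powr_le_samples:
  assumes r: "r \<ge> 1" and I: "open I" and reg: "sobolev_regular r I F" and p: "p \<ge> 1"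
    and K: "K > 0" and L: "b - a \<le> L" "K \<le> L" and ab: "{a..b} \<subseteq> I"
    and x: "\<And>i. i < r \<Longrightarrow> x i \<in> {a..b}"
    and sep: "\<And>i j. i < j \<Longrightarrow> j < r \<Longrightarrow> x j - x i \<ge> K"
    and t: "t \<in> {a..b}"
  shows "ennreal (cmod (F t) powr p) \<le> ennreal (sample_const r K L powr p) *
    ((\<Sum>i<r. ennreal (cmod (F (x i)) powr p)) +
      (\<integral>\<^sup>+x\<in>{a..b}. ennreal (cmod (nth_derivative I r F x) powr p) \<partial>lebesgue))"
proof -
  define C where "C = (L / K) ^ (r - 1) * (1 + (1 + real r) * L ^ (r - 1))"
  define P where "P = (\<integral>\<^sup>+x\<in>{a..b}. ennreal (cmod (nth_derivative I r F x) powr p) \<partial>lebesgue)"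
  have C: "C \<ge> 0" using K L by (simp add: C_def)
  have SC: "sample_const r K L = C * ((L + 1) * (real r + 1))" by (simp add: sample_const_def C_def)
  have SC0: "sample_const r K L > 0"
    using K L r by (auto simp: sample_const_def intro!: mult_pos_pos add_pos_nonneg)
  show ?thesis
  proof (cases P)
    case top
    then show ?thesis using SC0 by (simp add: P_def ennreal_mult_eq_top_iff ennreal_mult_top)
  next
    case (real P')
    have "ennreal (cmod (F t) powr p) \<le> ennreal (sample_const r K L powr p * ((\<Sum>i<r. cmod (F (x i)) powr p) + P')) + ennreal e"
      if e: "0 < e" for e
    proof -
      \<comment> \<open>The norm of the top derivative may vanish, while the threshold
        \<open>s\<close> has to be positive. The perturbation \<open>e'\<close> is scaled so that it
        costs exactly \<open>e\<close> in the end.\<close>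
      define e' where "e' = e / (sample_const r K L powr p)"
      have e': "e' > 0" using e SC0 by (simp add: e'_def)
      define s where "s = (P' + e') powr (1 / p)"
      have s: "s > 0" "s powr p = P' + e'"
        using e' real p by (auto simp: s_def powr_powr)
      have "(\<integral>\<^sup>+x\<in>{a..b}. ennreal (cmod (nth_derivative I r F x)) \<partial>lebesgue) \<le> ennreal ((b - a + 1) * s)"
      proof (rule nn_integral_le_of_powr[OF top_derivative_measurable[OF r I reg ab] _ p s(1)])
        show "(\<integral>\<^sup>+x\<in>{a..b}. ennreal (cmod (nth_derivative I r F x) powr p) \<partial>lebesgue) \<le> ennreal (s powr p)"
          using real e' unfolding P_def[symmetric] s(2) by (simp add: ennreal_leI)
      qed (use t in auto)
      also have "\<dots> \<le> ennreal ((L + 1) * s)"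
        using L s by (intro ennreal_leI mult_right_mono) auto
      finally have "cmod (F t) \<le> C * ((\<Sum>i<r. cmod (F (x i))) + (L + 1) * s)"
        unfolding C_def using K L s by (intro sobolev_norm_le_samples[OF r I reg K L ab x sep t]) auto
      then have "cmod (F t) powr p \<le> sample_const r K L powr p * ((\<Sum>i<r. cmod (F (x i)) powr p) + s powr p)"
        unfolding SC using C K L s p by (intro powr_sum_le) auto
      also have "\<dots> = sample_const r K L powr p * ((\<Sum>i<r. cmod (F (x i)) powr p) + P') + e"
        using SC0 by (simp add: s(2) e'_def field_simps)
      finally show ?thesis
        using e real by (simp flip: ennreal_plus add: sum_nonneg)
    qed
    then have "ennreal (cmod (F t) powr p) \<le> ennreal (sample_const r K L powr p * ((\<Sum>i<r. cmod (F (x i)) powr p) + P'))"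
      by (rule ennreal_le_epsilon)
    also have "\<dots> = ennreal (sample_const r K L powr p) * ((\<Sum>i<r. ennreal (cmod (F (x i)) powr p)) + P)"
      using real by (simp add: ennreal_mult ennreal_plus sum_nonneg sum_ennreal)
    finally show ?thesis by (simp add: P_def)
  qed
qed

subsection \<open>Node sums and local norms\<close>

lemma covered_interval_bracket:
  assumes "strict_mono l" "x \<in> covered_interval l"
  obtains m where "l m \<le> x" "x < l (m + 1)"
proof -
  obtain n where n: "l n \<le> x" "x \<le> l (n + 1)" using assms(2) by (auto simp: covered_interval_def)
  show ?thesis
  proof (cases "x = l (n + 1)")
    case True
    then show ?thesis using that[of "n + 1"] strict_monoD[OF assms(1), of "n + 1" "n + 1 + 1"] by simp
  next
    case False
    then show ?thesis using that[of n] n by simp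
  qed
qed

text \<open>The indices run over all integers, so every node has neighbours on both sides and is
  interior. Openness makes derivatives within \<open>I\<close> ordinary derivatives.\<close>

lemma open_covered_interval:
  assumes "strict_mono l"
  shows "open (covered_interval l)"
proof -
  have "covered_interval l = (\<Union>n. {l (n - 1)<..<l (n + 1)})"
  proof (intro equalityI subsetI)
    fix x assume "x \<in> covered_interval l"
    then obtain m where "l m \<le> x" "x < l (m + 1)" using assms covered_interval_bracket by blast
    moreover have "l (m - 1) < l m" using assms by (simp add: strict_mono_less)
    ultimately show "x \<in> (\<Union>n. {l (n - 1)<..<l (n + 1)})" by (intro UN_I[of m]) auto
  next
    fix x assume "x \<in> (\<Union>n. {l (n - 1)<..<l (n + 1)})"
    then obtain n where n: "l (n - 1) < x" "x < l (n + 1)" by auto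
    show "x \<in> covered_interval l"
    proof (cases "x \<le> l n")
      case True
      then show ?thesis using n unfolding covered_interval_def by (intro UN_I[of "n - 1"]) auto
    next
      case False
      then show ?thesis using n unfolding covered_interval_def by (intro UN_I[of n]) auto
    qed
  qed
  then show ?thesis by auto
qed

lemma nodes_subset_covered_interval:
  assumes "strict_mono l"
  shows "{l m..l n} \<subseteq> covered_interval l"
proof -
  have *: "{l m..l (m + int k)} \<subseteq> covered_interval l" for k
  proof (induction k)
    case 0
    have "l m \<in> {l m..l (m + 1)}" using assms by (simp add: strict_mono_less_eq)
    then show ?case by (auto simp: covered_interval_def)
  next
    case (Suc k)
    have "{l m..l (m + int (Suc k))} \<subseteq> {l m..l (m + int k)} \<union> {l (m + int k)..l (m + int k + 1)}"
      by (auto simp: algebra_simps)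
    then show ?case using Suc by (auto simp: covered_interval_def)
  qed
  show ?thesis
  proof (cases "m \<le> n")
    case True
    then show ?thesis using *[of "nat (n - m)"] by simp
  next
    case False
    then have "l n < l m" using assms by (simp add: strict_mono_less)
    then show ?thesis by simp
  qed
qed

text \<open>The nodes in \<open>{a<..b}\<close> are a block of consecutive indices, possibly empty,
  with bracketing nodes known at both ends; sums of the weights over it telescope.\<close>

lemma nodes_in_interval:
  assumes l: "strict_mono l" and ab: "a \<le> b" "{a..b} \<subseteq> covered_interval l"
  obtains m M where "m \<le> M" "l m \<le> a" "a < l (m + 1)" "l M \<le> b" "b < l (M + 1)"
    "{n. a < l n \<and> l n \<le> b} = {m + 1..M}"
proof -
  have abI: "a \<in> covered_interval l" "b \<in> covered_interval l" using ab by auto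
  obtain m where m: "l m \<le> a" "a < l (m + 1)"
    by (rule covered_interval_bracket[OF l abI(1)])
  obtain M where M: "l M \<le> b" "b < l (M + 1)"
    by (rule covered_interval_bracket[OF l abI(2)])
  have "l m < l (M + 1)" using m M ab by simp
  then have mM: "m \<le> M" using l by (simp add: strict_mono_less)
  have "a < l n \<longleftrightarrow> m + 1 \<le> n" for n
  proof -
    have "a < l n \<Longrightarrow> m < n" using m(1) strict_mono_less[OF l, of m n] by simp
    moreover have "m + 1 \<le> n \<Longrightarrow> a < l n" using m(2) strict_mono_less_eq[OF l, of "m + 1" n] by simp
    ultimately show ?thesis by auto
  qed
  moreover have "l n \<le> b \<longleftrightarrow> n \<le> M" for n
  proof -
    have "l n \<le> b \<Longrightarrow> n < M + 1" using M(2) strict_mono_less[OF l, of n "M + 1"] by simp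
    moreover have "n \<le> M \<Longrightarrow> l n \<le> b" using M(1) strict_mono_less_eq[OF l, of n M] by simp
    ultimately show ?thesis by auto
  qed
  ultimately have "{n. a < l n \<and> l n \<le> b} = {m + 1..M}" by auto
  then show ?thesis using that[of m M] m M mM by blast
qed

lemma sum_double_gaps:
  fixes l :: "int \<Rightarrow> real"
  assumes "m \<le> M"
  shows "(\<Sum>n\<in>{m + 1..M}. l (n + 1) - l (n - 1)) = l (M + 1) + l M - l (m + 1) - l m"
  using assms
proof (induction M rule: int_ge_induct)
  case (step i)
  have "{m + 1..i + 1} = insert (i + 1) {m + 1..i}" using step.hyps by auto
  then show ?case using step by (simp add: algebra_simps)
qed simp

text \<open>The half-open interval makes the sum additive over adjacent pieces without counting a
  common endpoint twice. The weights are those of the full sequence and may reach beyond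
  \<open>a\<close> and \<open>b\<close>.\<close>

definition node_sum :: "real \<Rightarrow> (int \<Rightarrow> real) \<Rightarrow> (real \<Rightarrow> complex) \<Rightarrow> real \<Rightarrow> real \<Rightarrow> ennreal" where
  "node_sum p l F a b = (\<Sum>n | a < l n \<and> l n \<le> b. ennreal ((l (n + 1) - l (n - 1)) * cmod (F (l n)) powr p))"

context
  fixes l :: "int \<Rightarrow> real"
  assumes l: "strict_mono l"
begin

lemma double_gap_nonneg: "l (n + 1) - l (n - 1) \<ge> 0"
  using strict_mono_less_eq[OF l, of "n - 1" "n + 1"] by simp

lemma finite_nodes:
  assumes "{a..b} \<subseteq> covered_interval l"
  shows "finite {n. a < l n \<and> l n \<le> b}"
proof (cases "a \<le> b")
  case True
  then show ?thesis using nodes_in_interval[OF l True assms] by (metis finite_atLeastAtMost_int)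
next
  case False
  then have "{n. a < l n \<and> l n \<le> b} = {}" by auto
  then show ?thesis by (simp only: finite.emptyI)
qed

lemma node_sum_split:
  assumes "a \<le> b" "b \<le> c" "{a..c} \<subseteq> covered_interval l"
  shows "node_sum p l F a c = node_sum p l F a b + node_sum p l F b c"
proof -
  have "{a..b} \<subseteq> covered_interval l" "{b..c} \<subseteq> covered_interval l" using assms by auto
  note fin = this[THEN finite_nodes]
  have "{n. a < l n \<and> l n \<le> c} = {n. a < l n \<and> l n \<le> b} \<union> {n. b < l n \<and> l n \<le> c}"
    using assms by auto
  then show ?thesis unfolding node_sum_def
    using sum.union_disjoint[OF fin, of "\<lambda>n. ennreal ((l (n + 1) - l (n - 1)) * cmod (F (l n)) powr p)"]
    by (simp add: disjoint_iff)
qed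

context
  fixes K :: real
  assumes gap: "\<And>n. l (n + 1) - l n \<le> K"
begin

text \<open>The window contains a node because gaps are at most \<open>K\<close>. The telescoped
  weight is at least \<open>l (M + 1) - l m\<close>, hence at least \<open>K\<close>, so the
  smallest nodal value times \<open>K\<close> is below the weighted sum.\<close>

lemma small_node_value:
  assumes K: "K > 0" and "{u..u + K} \<subseteq> covered_interval l"
  shows "\<exists>t\<in>{u..u + K}. ennreal K * ennreal (cmod (F t) powr p) \<le> node_sum p l F u (u + K)"
proof -
  obtain m M where mM: "m \<le> M" "l m \<le> u" "u < l (m + 1)" "l M \<le> u + K" "u + K < l (M + 1)"
    "{n. u < l n \<and> l n \<le> u + K} = {m + 1..M}"
    by (rule nodes_in_interval[OF l _ assms(2)]) (use K in auto)
  have "l (m + 1) \<le> u + K" using gap[of m] mM by simp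
  then have mM': "m + 1 \<le> M" using mM strict_mono_less[OF l, of "m + 1" "M + 1"] by simp
  define g where "g = (\<lambda>n. cmod (F (l n)) powr p)"
  obtain n where n: "n \<in> {m + 1..M}" "\<And>k. k \<in> {m + 1..M} \<Longrightarrow> g n \<le> g k"
    using ex_min_if_finite[of "g ` {m + 1..M}"] mM' by (force simp: not_less)
  have "K \<le> l (M + 1) + l M - l (m + 1) - l m"
    using mM mM' strict_mono_less_eq[OF l, of "m + 1" M] by simp
  then have "K * g n \<le> (\<Sum>k\<in>{m + 1..M}. l (k + 1) - l (k - 1)) * g n"
    unfolding sum_double_gaps[OF mM(1)] by (intro mult_right_mono) (auto simp: g_def)
  also have "\<dots> \<le> (\<Sum>k\<in>{m + 1..M}. (l (k + 1) - l (k - 1)) * g k)"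
    unfolding sum_distrib_right using n double_gap_nonneg by (intro sum_mono mult_left_mono) auto
  finally have "ennreal (K * g n) \<le> ennreal (\<Sum>k\<in>{m + 1..M}. (l (k + 1) - l (k - 1)) * g k)"
    by (rule ennreal_leI)
  also have "\<dots> = node_sum p l F u (u + K)"
    unfolding node_sum_def mM(6) g_def using double_gap_nonneg by (intro sum_ennreal[symmetric]) auto
  finally have "ennreal K * ennreal (cmod (F (l n)) powr p) \<le> node_sum p l F u (u + K)"
    using K by (simp add: g_def ennreal_mult)
  moreover have "n \<in> {n. u < l n \<and> l n \<le> u + K}" unfolding mM(6) by (rule n(1))
  then have "l n \<in> {u..u + K}" by simp
  ultimately show ?thesis by blast
qed

text \<open>The telescoped weight is at most \<open>2 * (b - a)\<close> plus the overhang at the two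
  ends, which is at most \<open>K\<close> each.\<close>

lemma node_sum_le:
  assumes ab: "a \<le> b" "{a..b} \<subseteq> covered_interval l"
    and B: "\<And>t. t \<in> {a..b} \<Longrightarrow> ennreal (cmod (F t) powr p) \<le> B"
  shows "node_sum p l F a b \<le> ennreal (2 * (b - a) + 2 * K) * B"
proof -
  obtain m M where mM: "m \<le> M" "l m \<le> a" "a < l (m + 1)" "l M \<le> b" "b < l (M + 1)"
    "{n. a < l n \<and> l n \<le> b} = {m + 1..M}"
    using nodes_in_interval[OF l ab] by blast
  have "node_sum p l F a b \<le> (\<Sum>n | a < l n \<and> l n \<le> b. ennreal (l (n + 1) - l (n - 1)) * B)"
    unfolding node_sum_def using double_gap_nonneg B
    by (intro sum_mono) (auto simp: ennreal_mult intro!: mult_left_mono)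
  also have "\<dots> = ennreal (\<Sum>n\<in>{m + 1..M}. l (n + 1) - l (n - 1)) * B"
    unfolding mM(6) using double_gap_nonneg by (simp add: sum_distrib_right[symmetric] sum_ennreal)
  also have "\<dots> \<le> ennreal (2 * (b - a) + 2 * K) * B"
    unfolding sum_double_gaps[OF mM(1)]
    using gap[of m] gap[of M] mM by (intro mult_right_mono ennreal_leI) auto
  finally show ?thesis .
qed

end

end

section \<open>Integrals over half-open pieces\<close>

lemma Lp_power_Ioc_eq_Icc: "Lp_power p {a<..b} F = Lp_power p {a..b} F"
  unfolding Lp_power_def
proof (rule nn_integral_cong_AE)
  have "AE x in lebesgue. x \<noteq> a"
    by (rule AE_I'[of "{a}"]) (auto simp flip: negligible_iff_null_sets)
  then show "AE x in lebesgue. ennreal (cmod (F x) powr p) * indicator {a<..b} x =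
      ennreal (cmod (F x) powr p) * indicator {a..b} x"
    by (rule AE_mp) (auto simp: indicator_def)
qed

lemma Lp_power_mono: "A \<subseteq> B \<Longrightarrow> Lp_power p A F \<le> Lp_power p B F"
  unfolding Lp_power_def by (intro nn_integral_mono) (auto simp: indicator_def)

lemma Lp_power_split:
  assumes F: "F \<in> borel_measurable (lebesgue_on {a..c})" and "a \<le> b" "b \<le> c"
  shows "Lp_power p {a<..c} F = Lp_power p {a<..b} F + Lp_power p {b<..c} F"
proof -
  \<comment> \<open>\<open>F\<close> is measurable only on \<open>{a..c}\<close>; the cut-off
    integrand is measurable on the line, as additivity of the integral requires.\<close>
  define g where "g = (\<lambda>x. ennreal (cmod (F x) powr p) * indicator {a..c} x)"
  have "(\<lambda>x. ennreal (cmod (F x) powr p)) \<in> borel_measurable (lebesgue_on {a..c})" using F by measurable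
  then have g: "g \<in> borel_measurable lebesgue"
    unfolding g_def by (subst (asm) borel_measurable_restrict_space_iff_ennreal) auto
  have "(\<integral>\<^sup>+x\<in>{a<..b} \<union> {b<..c}. g x \<partial>lebesgue) = (\<integral>\<^sup>+x\<in>{a<..b}. g x \<partial>lebesgue) + (\<integral>\<^sup>+x\<in>{b<..c}. g x \<partial>lebesgue)"
    by (rule nn_integral_disjoint_pair[OF g]) auto
  moreover have "{a<..b} \<union> {b<..c} = {a<..c}" using assms by auto
  moreover have "(\<integral>\<^sup>+x\<in>S. g x \<partial>lebesgue) = Lp_power p S F" if "S \<subseteq> {a..c}" for S
    unfolding Lp_power_def g_def using that by (intro nn_integral_cong) (auto simp: indicator_def)
  ultimately show ?thesis using assms by (simp add: subset_iff)
qed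

lemma Lp_power_Ioc_le:
  assumes "a \<le> b" and B: "\<And>t. t \<in> {a..b} \<Longrightarrow> ennreal (cmod (F t) powr p) \<le> B"
  shows "Lp_power p {a<..b} F \<le> ennreal (b - a) * B"
proof -
  have "Lp_power p {a<..b} F \<le> (\<integral>\<^sup>+x. B * indicator {a<..b} x \<partial>lebesgue)"
    unfolding Lp_power_def using B by (intro nn_integral_mono) (auto simp: indicator_def)
  also have "\<dots> = ennreal (b - a) * B"
    using assms by (simp add: nn_integral_cmult_indicator mult.commute)
  finally show ?thesis .
qed

lemma small_value_of_Lp_power:
  assumes F: "continuous_on {u..u + K} F" and K: "K > 0" and p: "p > 0"
  shows "\<exists>t\<in>{u..u + K}. ennreal K * ennreal (cmod (F t) powr p) \<le> Lp_power p {u<..u + K} F"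
proof -
  have "continuous_on {u..u + K} (\<lambda>x. cmod (F x))" using F by (intro continuous_intros)
  then obtain t where t: "t \<in> {u..u + K}" "\<And>x. x \<in> {u..u + K} \<Longrightarrow> cmod (F t) \<le> cmod (F x)"
    using continuous_attains_inf[of "{u..u + K}" "\<lambda>x. cmod (F x)"] K by auto
  have "ennreal (cmod (F t) powr p) * emeasure lebesgue {u<..u + K} = (\<integral>\<^sup>+x. ennreal (cmod (F t) powr p) * indicator {u<..u + K} x \<partial>lebesgue)"
    by (rule nn_integral_cmult_indicator[symmetric]) simp
  also have "\<dots> \<le> Lp_power p {u<..u + K} F"
    unfolding Lp_power_def using t p
    by (intro nn_integral_mono) (auto simp: indicator_def intro!: ennreal_leI powr_mono2)
  finally show ?thesis using t(1) K by (intro bexI[of _ t]) (auto simp: mult.commute)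
qed

text \<open>Pieces have length at most \<open>4 * r * K\<close>, so
  \<open>2 * (4 * r * K) + 2 * K\<close> bounds their nodal weight and also their length. The factor
  \<open>r / K\<close> comes from adding \<open>r\<close> samples, each bounded by a local quantity
  over \<open>K\<close>. The outer \<open>max 1\<close> ensures that the first factor is at most its
  own p-th power.\<close>

definition discretization_const :: "nat \<Rightarrow> real \<Rightarrow> real" where
  "discretization_const r K =
     max 1 ((2 * (4 * real r * K) + 2 * K) * max 1 (real r / K)) * sample_const r K (4 * real r * K)"

lemma sample_const_pos: "r \<ge> 1 \<Longrightarrow> K > 0 \<Longrightarrow> L > 0 \<Longrightarrow> sample_const r K L > 0"
  by (auto simp: sample_const_def intro!: mult_pos_pos add_pos_nonneg)

lemma discretization_const_pos: "r \<ge> 1 \<Longrightarrow> K > 0 \<Longrightarrow> discretization_const r K > 0"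
  by (auto simp: discretization_const_def intro!: mult_pos_pos sample_const_pos)

text \<open>Serves both local inequalities: \<open>w\<close> is the length of the piece for the
  integral of \<open>|F|^p\<close> and the bound on its nodal weight for the node sum.\<close>

lemma discretization_const_le:
  assumes r: "r \<ge> 1" and K: "K > 0" and p: "p \<ge> 1"
    and w: "0 \<le> w" "w \<le> 2 * (4 * real r * K) + 2 * K"
  shows "ennreal w * (ennreal (sample_const r K (4 * real r * K) powr p) * (ennreal (real r / K) * X + Y))
    \<le> ennreal (discretization_const r K powr p) * (X + Y)"
proof -
  define W where "W = 2 * (4 * real r * K) + 2 * K"
  define D where "D = sample_const r K (4 * real r * K)"
  define m where "m = max 1 (real r / K)"
  have "ennreal (real r / K) * X + Y \<le> ennreal m * X + ennreal m * Y"
  proof (rule add_mono)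
    show "ennreal (real r / K) * X \<le> ennreal m * X"
      by (intro mult_right_mono ennreal_leI) (auto simp: m_def)
    have "1 * Y \<le> ennreal m * Y"
      by (intro mult_right_mono) (auto simp: m_def)
    then show "Y \<le> ennreal m * Y" by simp
  qed
  then have "ennreal w * (ennreal (D powr p) * (ennreal (real r / K) * X + Y))
      \<le> ennreal W * (ennreal (D powr p) * (ennreal m * (X + Y)))"
    using w by (intro mult_mono ennreal_leI) (auto simp: W_def distrib_left)
  also have "\<dots> = ennreal (W * D powr p * m) * (X + Y)"
    using K by (simp add: ennreal_mult W_def m_def mult.assoc)
  also have "\<dots> \<le> ennreal ((max 1 (W * m) * D) powr p) * (X + Y)"
  proof (intro mult_right_mono ennreal_leI)
    have "W * m \<le> max 1 (W * m) powr 1" by simp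
    also have "\<dots> \<le> max 1 (W * m) powr p" using p by (intro powr_mono) auto
    finally have "W * m * D powr p \<le> max 1 (W * m) powr p * D powr p"
      by (intro mult_right_mono) auto
    then show "W * D powr p * m \<le> (max 1 (W * m) * D) powr p"
      by (simp add: powr_mult mult_ac)
  qed simp
  finally show ?thesis by (simp add: discretization_const_def W_def D_def m_def)
qed

text \<open>Pieces of length \<open>H\<close> are cut off on the left as long as the interval is
  longer than \<open>2 * H\<close>. What remains is then longer than \<open>H\<close>, so the last
  piece is again of admissible length.\<close>

lemma interval_le_by_pieces:
  fixes f g :: "real \<Rightarrow> real \<Rightarrow> ennreal"
  assumes H: "H > 0"
    and local: "\<And>a b. \<alpha> \<le> a \<Longrightarrow> b \<le> \<beta> \<Longrightarrow> H \<le> b - a \<Longrightarrow> b - a \<le> 2 * H \<Longrightarrow> f a b \<le> g a b"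
    and f: "\<And>a b c. \<alpha> \<le> a \<Longrightarrow> a \<le> b \<Longrightarrow> b \<le> c \<Longrightarrow> c \<le> \<beta> \<Longrightarrow> f a c \<le> f a b + f b c"
    and g: "\<And>a b c. \<alpha> \<le> a \<Longrightarrow> a \<le> b \<Longrightarrow> b \<le> c \<Longrightarrow> c \<le> \<beta> \<Longrightarrow> g a b + g b c \<le> g a c"
    and len: "H \<le> \<beta> - \<alpha>"
  shows "f \<alpha> \<beta> \<le> g \<alpha> \<beta>"
proof -
  have "f a \<beta> \<le> g a \<beta>" if "\<alpha> \<le> a" "H \<le> \<beta> - a" "\<beta> - a \<le> (real n + 2) * H" for n a
    using that
  proof (induction n arbitrary: a)
    case 0
    then show ?case by (intro local) auto
  next
    case (Suc n)
    show ?case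
    proof (cases "\<beta> - a \<le> 2 * H")
      case True
      then show ?thesis using Suc.prems by (intro local) auto
    next
      case False
      have "f a \<beta> \<le> f a (a + H) + f (a + H) \<beta>" using Suc.prems H by (intro f) auto
      also have "\<dots> \<le> g a (a + H) + g (a + H) \<beta>"
        using Suc False H by (intro add_mono local Suc.IH) (auto simp: algebra_simps)
      also have "\<dots> \<le> g a \<beta>" using Suc.prems H by (intro g) auto
      finally show ?thesis .
    qed
  qed
  from this[of \<alpha> "nat \<lceil>(\<beta> - \<alpha>) / H\<rceil>"] show ?thesis
  proof -
    assume *: "\<alpha> \<le> \<alpha> \<Longrightarrow> H \<le> \<beta> - \<alpha> \<Longrightarrow> \<beta> - \<alpha> \<le> (real (nat \<lceil>(\<beta> - \<alpha>) / H\<rceil>) + 2) * H \<Longrightarrow> f \<alpha> \<beta> \<le> g \<alpha> \<beta>"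
    have "(\<beta> - \<alpha>) / H \<le> real (nat \<lceil>(\<beta> - \<alpha>) / H\<rceil>)" by linarith
    then have "\<beta> - \<alpha> \<le> real (nat \<lceil>(\<beta> - \<alpha>) / H\<rceil>) * H" using H by (simp add: field_simps)
    also have "\<dots> \<le> (real (nat \<lceil>(\<beta> - \<alpha>) / H\<rceil>) + 2) * H" using H by (intro mult_right_mono) auto
    finally show ?thesis using * len by simp
  qed
qed

section \<open>The two inequalities on compact intervals\<close>

context
  fixes l :: "int \<Rightarrow> real" and K p :: real and r :: nat and F :: "real \<Rightarrow> complex" and I :: "real set"
  assumes l: "strict_mono l" and gap: "\<And>n. l (n + 1) - l n \<le> K" and K: "K > 0"
    and r: "r \<ge> 1" and p: "p \<ge> 1" and I: "I = covered_interval l" and reg: "sobolev_regular r I F"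
begin

lemma open_I: "open I"
  using open_covered_interval[OF l] I by simp

text \<open>The quantity \<open>A\<close> is left open so that both inequalities can use the lemma,
  with the node sum or the integral of \<open>|F|^p\<close> as supplier of small values in windows
  of length \<open>K\<close>.\<close>

lemma local_sup_le:
  assumes ab: "{a..b} \<subseteq> I" "2 * real r * K \<le> b - a" "b - a \<le> 4 * real r * K"
    and A: "\<And>u. a \<le> u \<Longrightarrow> u + K \<le> b \<Longrightarrow> \<exists>t\<in>{u..u + K}. ennreal K * ennreal (cmod (F t) powr p) \<le> A"
    and t: "t \<in> {a..b}"
  shows "ennreal (cmod (F t) powr p) \<le> ennreal (sample_const r K (4 * real r * K) powr p) *
    (ennreal (real r / K) * A + Lp_power p {a<..b} (nth_derivative I r F))"
proof -
  \<comment> \<open>Windows of length \<open>K\<close> start every \<open>2 * K\<close>. The last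
    ends at \<open>a + (2 * r - 1) * K\<close>, hence before \<open>b\<close>, and points of
    different windows are at least \<open>K\<close> apart.\<close>
  define u where "u = (\<lambda>i::nat. a + 2 * real i * K)"
  have u: "a \<le> u i" "u i + K \<le> b" if "i < r" for i
  proof -
    show "a \<le> u i" using K by (simp add: u_def)
    have "(2 * real i + 1) * K \<le> 2 * real r * K" using that K by (intro mult_right_mono) auto
    then show "u i + K \<le> b" using ab by (simp add: u_def algebra_simps)
  qed
  have "\<exists>t. t \<in> {u i..u i + K} \<and> ennreal K * ennreal (cmod (F t) powr p) \<le> A" if "i < r" for i
    using A[OF u[OF that]] by blast
  then obtain x where x: "\<And>i. i < r \<Longrightarrow> x i \<in> {u i..u i + K}"
    "\<And>i. i < r \<Longrightarrow> ennreal K * ennreal (cmod (F (x i)) powr p) \<le> A" by metis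
  have sep: "x j - x i \<ge> K" if "i < j" "j < r" for i j
  proof -
    have "u i + 2 * K \<le> u j"
      using that K mult_right_mono[of "real i + 1" "real j" K] by (simp add: u_def algebra_simps)
    then show ?thesis using x(1)[of i] x(1)[of j] that by auto
  qed
  have "(1::real) \<le> 4 * real r" using r by simp
  then have "1 * K \<le> 4 * real r * K" using K by (intro mult_right_mono) auto
  then have "ennreal (cmod (F t) powr p) \<le> ennreal (sample_const r K (4 * real r * K) powr p) *
    ((\<Sum>i<r. ennreal (cmod (F (x i)) powr p)) +
      (\<integral>\<^sup>+x\<in>{a..b}. ennreal (cmod (nth_derivative I r F x) powr p) \<partial>lebesgue))"
    using ab x(1) u sep t by (intro sobolev_powr_le_samples[OF r open_I reg p K]) (force+)
  also have "(\<Sum>i<r. ennreal (cmod (F (x i)) powr p)) \<le> ennreal (real r / K) * A"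
  proof -
    have "ennreal (cmod (F (x i)) powr p) \<le> ennreal (1 / K) * A" if "i < r" for i
    proof -
      have "ennreal (cmod (F (x i)) powr p) = ennreal (1 / K) * (ennreal K * ennreal (cmod (F (x i)) powr p))"
        using K by (simp flip: mult.assoc ennreal_mult)
      also have "\<dots> \<le> ennreal (1 / K) * A" using x(2)[OF that] by (intro mult_left_mono) auto
      finally show ?thesis .
    qed
    then have "(\<Sum>i<r. ennreal (cmod (F (x i)) powr p)) \<le> (\<Sum>i<r. ennreal (1 / K) * A)"
      by (intro sum_mono) auto
    also have "\<dots> = ennreal (real r / K) * A"
      using K by (simp add: mult.assoc[symmetric] ennreal_of_nat_eq_real_of_nat ennreal_mult[symmetric])
    finally show ?thesis .
  qed
  finally show ?thesis
    unfolding Lp_power_Ioc_eq_Icc unfolding Lp_power_def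
    by (simp add: add_right_mono mult_left_mono)
qed

lemma F_measurable: "{a..b} \<subseteq> I \<Longrightarrow> F \<in> borel_measurable (lebesgue_on {a..b})"
  using continuous_on_subset[OF continuous_on_sobolev_regular[OF r open_I reg]]
  by (intro continuous_imp_measurable_on_sets_lebesgue) auto

lemma Lp_power_le_local:
  assumes ab: "{a..b} \<subseteq> I" "2 * real r * K \<le> b - a" "b - a \<le> 4 * real r * K"
  shows "Lp_power p {a<..b} F \<le> ennreal (discretization_const r K powr p) *
    (node_sum p l F a b + Lp_power p {a<..b} (nth_derivative I r F))"
proof -
  have ale: "a \<le> b" using ab K by (smt (verit) mult_nonneg_nonneg of_nat_0_le_iff)
  have A: "\<exists>t\<in>{u..u + K}. ennreal K * ennreal (cmod (F t) powr p) \<le> node_sum p l F a b"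
    if u: "a \<le> u" "u + K \<le> b" for u
  proof -
    have s: "{u..u + K} \<subseteq> covered_interval l" "{a..u + K} \<subseteq> covered_interval l" "{a..b} \<subseteq> covered_interval l"
      using ab u I by auto
    have "node_sum p l F u (u + K) \<le> node_sum p l F a (u + K)"
      using node_sum_split[OF l u(1) _ s(2), where p = p and F = F] K by simp
    also have "\<dots> \<le> node_sum p l F a b"
      using node_sum_split[OF l _ u(2) s(3), where p = p and F = F] K u by simp
    finally show ?thesis using small_node_value[OF l gap K s(1), where p = p and F = F] by (meson order_trans)
  qed
  show ?thesis
    by (rule order_trans[OF Lp_power_Ioc_le[OF ale local_sup_le[OF ab A]]
          discretization_const_le[OF r K p]]) (use ab ale K in auto)
qed

lemma node_sum_le_local:
  assumes ab: "{a..b} \<subseteq> I" "2 * real r * K \<le> b - a" "b - a \<le> 4 * real r * K"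
  shows "node_sum p l F a b \<le> ennreal (discretization_const r K powr p) *
    (Lp_power p {a<..b} F + Lp_power p {a<..b} (nth_derivative I r F))"
proof -
  have ale: "a \<le> b" using ab K by (smt (verit) mult_nonneg_nonneg of_nat_0_le_iff)
  have ab': "{a..b} \<subseteq> covered_interval l" using ab I by simp
  have A: "\<exists>t\<in>{u..u + K}. ennreal K * ennreal (cmod (F t) powr p) \<le> Lp_power p {a<..b} F"
    if u: "a \<le> u" "u + K \<le> b" for u
  proof -
    have "{u..u + K} \<subseteq> I" using ab u by auto
    then have "continuous_on {u..u + K} F"
      using continuous_on_sobolev_regular[OF r open_I reg] by (rule continuous_on_subset[rotated])
    then obtain t where "t \<in> {u..u + K}" "ennreal K * ennreal (cmod (F t) powr p) \<le> Lp_power p {u<..u + K} F"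
      using small_value_of_Lp_power[of u K F p] K p by auto
    moreover have "Lp_power p {u<..u + K} F \<le> Lp_power p {a<..b} F"
      using u by (intro Lp_power_mono) auto
    ultimately show ?thesis using order_trans by blast
  qed
  show ?thesis
    by (rule order_trans[OF node_sum_le[OF l gap ale ab' local_sup_le[OF ab A]]
          discretization_const_le[OF r K p]]) (use ab ale K in auto)
qed

lemma Lp_power_le_compact:
  assumes ab: "{a..b} \<subseteq> I" "2 * real r * K \<le> b - a"
  shows "Lp_power p {a<..b} F \<le> ennreal (discretization_const r K powr p) *
    (node_sum p l F a b + Lp_power p {a<..b} (nth_derivative I r F))"
proof (rule interval_le_by_pieces[of "2 * real r * K" a b "\<lambda>a b. Lp_power p {a<..b} F"
      "\<lambda>a b. ennreal (discretization_const r K powr p) *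
        (node_sum p l F a b + Lp_power p {a<..b} (nth_derivative I r F))"])
  fix u v w assume u: "a \<le> u" "u \<le> v" "v \<le> w" "w \<le> b"
  then have s: "{u..w} \<subseteq> I" "{u..w} \<subseteq> covered_interval l" using ab I by auto
  show "Lp_power p {u<..w} F \<le> Lp_power p {u<..v} F + Lp_power p {v<..w} F"
    using Lp_power_split[OF F_measurable[OF s(1)] u(2,3)] by simp
  show "ennreal (discretization_const r K powr p) * (node_sum p l F u v + Lp_power p {u<..v} (nth_derivative I r F))
    + ennreal (discretization_const r K powr p) * (node_sum p l F v w + Lp_power p {v<..w} (nth_derivative I r F))
    \<le> ennreal (discretization_const r K powr p) * (node_sum p l F u w + Lp_power p {u<..w} (nth_derivative I r F))"
    using Lp_power_split[OF top_derivative_measurable[OF r open_I reg s(1)] u(2,3)]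
      node_sum_split[OF l u(2,3) s(2)]
    by (simp add: algebra_simps)
next
  fix u v assume "a \<le> u" "v \<le> b" "2 * real r * K \<le> v - u" "v - u \<le> 2 * (2 * real r * K)"
  then show "Lp_power p {u<..v} F \<le> ennreal (discretization_const r K powr p) *
    (node_sum p l F u v + Lp_power p {u<..v} (nth_derivative I r F))"
    using ab by (intro Lp_power_le_local) auto
qed (use ab r K in auto)

lemma node_sum_le_compact:
  assumes ab: "{a..b} \<subseteq> I" "2 * real r * K \<le> b - a"
  shows "node_sum p l F a b \<le> ennreal (discretization_const r K powr p) *
    (Lp_power p {a<..b} F + Lp_power p {a<..b} (nth_derivative I r F))"
proof (rule interval_le_by_pieces[of "2 * real r * K" a b "\<lambda>a b. node_sum p l F a b"
      "\<lambda>a b. ennreal (discretization_const r K powr p) *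
        (Lp_power p {a<..b} F + Lp_power p {a<..b} (nth_derivative I r F))"])
  fix u v w assume u: "a \<le> u" "u \<le> v" "v \<le> w" "w \<le> b"
  then have s: "{u..w} \<subseteq> I" "{u..w} \<subseteq> covered_interval l" using ab I by auto
  show "node_sum p l F u w \<le> node_sum p l F u v + node_sum p l F v w"
    using node_sum_split[OF l u(2,3) s(2)] by simp
  show "ennreal (discretization_const r K powr p) * (Lp_power p {u<..v} F + Lp_power p {u<..v} (nth_derivative I r F))
    + ennreal (discretization_const r K powr p) * (Lp_power p {v<..w} F + Lp_power p {v<..w} (nth_derivative I r F))
    \<le> ennreal (discretization_const r K powr p) * (Lp_power p {u<..w} F + Lp_power p {u<..w} (nth_derivative I r F))"
    using Lp_power_split[OF top_derivative_measurable[OF r open_I reg s(1)] u(2,3)]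
      Lp_power_split[OF F_measurable[OF s(1)] u(2,3)]
    by (simp add: algebra_simps)
next
  fix u v assume "a \<le> u" "v \<le> b" "2 * real r * K \<le> v - u" "v - u \<le> 2 * (2 * real r * K)"
  then show "node_sum p l F u v \<le> ennreal (discretization_const r K powr p) *
    (Lp_power p {u<..v} F + Lp_power p {u<..v} (nth_derivative I r F))"
    using ab by (intro node_sum_le_local) auto
qed (use ab r K in auto)

end

subsection \<open>Trace norms\<close>

lemma ennreal_root_mono:
  assumes "x \<le> y" "p > 0"
  shows "ennreal_root p x \<le> ennreal_root p y"
proof (cases "y = \<infinity>")
  case False
  then have "x \<noteq> \<infinity>" using assms(1) by (metis infinity_ennreal_def top.extremum_unique)
  then show ?thesis using assms False
    by (auto simp: ennreal_root_def top.not_eq_extremum intro!: ennreal_leI powr_mono2 enn2real_mono)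
qed (simp add: ennreal_root_def)

lemma ennreal_root_powr_mult:
  assumes "c > 0" "p > 0"
  shows "ennreal_root p (ennreal (c powr p) * x) = ennreal c * ennreal_root p x"
proof (cases "x = \<infinity>")
  case True
  then show ?thesis using assms by (simp add: ennreal_root_def ennreal_mult_top)
next
  case False
  then have "ennreal (c powr p) * x \<noteq> \<infinity>" by (simp add: ennreal_mult_eq_top_iff)
  then show ?thesis using False assms
    by (simp add: ennreal_root_def enn2real_mult powr_mult powr_powr ennreal_mult)
qed

text \<open>The factor 2 is uniform in \<open>p\<close>: \<open>x + y\<close> is at most
  \<open>2 * max x y\<close>, and \<open>2 <= 2 powr p\<close>.\<close>

lemma ennreal_root_add_le:
  assumes p: "p \<ge> 1"
  shows "ennreal_root p (x + y) \<le> ennreal 2 * (ennreal_root p x + ennreal_root p y)"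
proof -
  have "x + y \<le> 2 * max x y"
    unfolding mult_2 by (intro add_mono) auto
  also have "\<dots> \<le> ennreal (2 powr p) * max x y"
  proof (intro mult_right_mono)
    have "(2::real) powr 1 \<le> 2 powr p" using p by (intro powr_mono) auto
    then have "ennreal 2 \<le> ennreal (2 powr p)" by (intro ennreal_leI) simp
    then show "2 \<le> ennreal (2 powr p)" by simp
  qed simp
  finally have "ennreal_root p (x + y) \<le> ennreal 2 * ennreal_root p (max x y)"
    using ennreal_root_mono[of "x + y" "ennreal (2 powr p) * max x y" p] p
    by (simp add: ennreal_root_powr_mult)
  also have "ennreal_root p (max x y) \<le> ennreal_root p x + ennreal_root p y"
    by (auto simp: max_def add_increasing add_increasing2)
  finally show ?thesis by (simp add: mult_left_mono)
qed

definition nodal_power :: "real \<Rightarrow> (int \<Rightarrow> real) \<Rightarrow> (real \<Rightarrow> complex) \<Rightarrow> ennreal" where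
  "nodal_power p l f = (\<Sum>\<^sub>\<infinity>n\<in>UNIV. ennreal ((l (n + 1) - l (n - 1)) * cmod (f (l n)) powr p))"

lemma nodal_power_eq_SUP:
  "nodal_power p l f = (SUP A\<in>{A. finite A}. \<Sum>n\<in>A. ennreal ((l (n + 1) - l (n - 1)) * cmod (f (l n)) powr p))"
  unfolding nodal_power_def by (subst nonneg_infsum_complete) auto

text \<open>All extensions of one trace have the same nodal part. This is the link between different
  extensions in both parts of the theorem.\<close>

lemma nodal_power_restriction: "nodal_power p l (restriction F (range l)) = nodal_power p l F"
  by (simp add: nodal_power_def restriction_def)

lemma covered_interval_eq_UN_nodes:
  assumes l: "strict_mono l"
  shows "covered_interval l = (\<Union>n::nat. {l (- int n)<..l (int n)})"
proof (intro equalityI subsetI)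
  fix x assume "x \<in> covered_interval l"
  then obtain m where m: "l m \<le> x" "x < l (m + 1)" using covered_interval_bracket[OF l] by blast
  define n where "n = nat (\<bar>m\<bar> + 1)"
  have "- int n < m" "m + 1 \<le> int n" by (auto simp: n_def)
  then have "l (- int n) < l m" "l (m + 1) \<le> l (int n)"
    using l by (auto simp: strict_mono_less strict_mono_less_eq)
  then show "x \<in> (\<Union>n::nat. {l (- int n)<..l (int n)})" using m by (intro UN_I[of n]) auto
next
  fix x assume "x \<in> (\<Union>n::nat. {l (- int n)<..l (int n)})"
  then obtain n :: nat where "l (- int n) < x" "x \<le> l (int n)" by auto
  then have "x \<in> {l (- int n)..l (int n)}" by simp
  then show "x \<in> covered_interval l" using nodes_subset_covered_interval[OF l] by blast
qed

lemma incseq_nodes: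
  assumes l: "strict_mono l"
  shows "incseq (\<lambda>n::nat. {l (- int n)<..l (int n)})"
proof (intro monoI)
  fix m n :: nat assume "m \<le> n"
  then have "l (- int n) \<le> l (- int m)" "l (int m) \<le> l (int n)"
    using l by (auto simp: strict_mono_less_eq)
  then show "{l (- int m)<..l (int m)} \<le> {l (- int n)<..l (int n)}" by auto
qed

text \<open>The length assumption on \<open>I\<close> enters here. If all node intervals
  \<open>{l (- int n)<..l (int n)}\<close> were no longer than \<open>2 * r * K\<close>, continuity
  of measure from below would give the same bound for \<open>I\<close>.\<close>

lemma eventually_long:
  assumes adm: "admissible_sequence r K l" and K: "K > 0"
  obtains n0 :: nat where "\<And>n. n \<ge> n0 \<Longrightarrow> 2 * real r * K \<le> l (int n) - l (- int n)"
proof -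
  have l: "strict_mono l" using adm by (simp add: admissible_sequence_def)
  have "\<exists>n::nat. 2 * real r * K \<le> l (int n) - l (- int n)"
  proof (rule ccontr)
    assume "\<not> ?thesis"
    then have less: "l (int n) - l (- int n) \<le> 2 * real r * K" for n :: nat
      by (meson linear)
    have "emeasure lborel (covered_interval l) = (SUP n::nat. emeasure lborel {l (- int n)<..l (int n)})"
      unfolding covered_interval_eq_UN_nodes[OF l]
      by (rule SUP_emeasure_incseq[symmetric]) (auto intro: incseq_nodes[OF l])
    also have "\<dots> \<le> ennreal (2 * real r * K)"
    proof (rule SUP_least)
      fix n :: nat
      have "l (- int n) \<le> l (int n)" using l by (simp add: strict_mono_less_eq)
      then show "emeasure lborel {l (- int n)<..l (int n)} \<le> ennreal (2 * real r * K)"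
        using less[of n] by (simp add: ennreal_leI)
    qed
    finally have "ennreal ((4 * real r + 2) * K) \<le> ennreal (2 * real r * K)"
      using adm by (auto simp: admissible_sequence_def)
    then have "(4 * real r + 2) * K \<le> 2 * real r * K" using K by (simp add: ennreal_le_iff)
    moreover have "2 * real r * K < (4 * real r + 2) * K" using K by (intro mult_strict_right_mono) auto
    ultimately show False by simp
  qed
  then obtain n0 :: nat where n0: "2 * real r * K \<le> l (int n0) - l (- int n0)" by blast
  show ?thesis
  proof (rule that)
    fix n assume "n \<ge> n0"
    then have "l (- int n) \<le> l (- int n0)" "l (int n0) \<le> l (int n)"
      using l by (auto simp: strict_mono_less_eq)
    then show "2 * real r * K \<le> l (int n) - l (- int n)" using n0 by simp
  qed
qed

section \<open>The two inequalities on all of \<open>I\<close>\<close>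

context
  fixes l :: "int \<Rightarrow> real" and K p :: real and r :: nat and I :: "real set"
  assumes adm: "admissible_sequence r K l" and K: "K > 0"
    and r: "r \<ge> 1" and p: "p \<ge> 1" and I: "I = covered_interval l"
begin

lemma strict_mono_nodes: "strict_mono l"
  using adm by (simp add: admissible_sequence_def)

lemma node_gap: "l (n + 1) - l n \<le> K"
  using adm by (simp add: admissible_sequence_def)

text \<open>Writing the integral as a measure with density reduces the exhaustion to continuity from
  below. It is applied to \<open>F\<close> only; for the top derivative monotonicity in the domain
  suffices.\<close>

lemma Lp_power_eq_SUP:
  assumes "continuous_on I F"
  shows "Lp_power p I F = (SUP n::nat. Lp_power p {l (- int n)<..l (int n)} F)"
proof -
  have Im: "I \<in> sets lebesgue" using open_covered_interval[OF strict_mono_nodes] I by auto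
  define g where "g = (\<lambda>x. ennreal (cmod (F x) powr p) * indicator I x)"
  have "F \<in> borel_measurable (lebesgue_on I)"
    by (rule continuous_imp_measurable_on_sets_lebesgue[OF assms Im])
  then have "(\<lambda>x. ennreal (cmod (F x) powr p)) \<in> borel_measurable (lebesgue_on I)" by measurable
  then have g: "g \<in> borel_measurable lebesgue"
    unfolding g_def using Im by (subst (asm) borel_measurable_restrict_space_iff_ennreal) auto
  have eq: "Lp_power p S F = emeasure (density lebesgue g) S" if "S \<subseteq> I" "S \<in> sets lebesgue" for S
  proof -
    have "emeasure (density lebesgue g) S = (\<integral>\<^sup>+x\<in>S. g x \<partial>lebesgue)"
      by (rule emeasure_density[OF g that(2)])
    also have "\<dots> = Lp_power p S F"
      unfolding Lp_power_def g_def using that(1) by (intro nn_integral_cong) (auto simp: indicator_def)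
    finally show ?thesis by simp
  qed
  have UN: "I = (\<Union>n::nat. {l (- int n)<..l (int n)})"
    using covered_interval_eq_UN_nodes[OF strict_mono_nodes] I by simp
  have "emeasure (density lebesgue g) I = (SUP n::nat. emeasure (density lebesgue g) {l (- int n)<..l (int n)})"
    by (subst UN, rule SUP_emeasure_incseq[symmetric]) (auto intro: incseq_nodes[OF strict_mono_nodes])
  moreover have "Lp_power p {l (- int n)<..l (int n)} F = emeasure (density lebesgue g) {l (- int n)<..l (int n)}" for n
    using UN by (intro eq) auto
  ultimately show ?thesis using eq[of I] Im by simp
qed

lemma nodes_subset_I: "{l m..l n} \<subseteq> I"
  using nodes_subset_covered_interval[OF strict_mono_nodes] I by simp

lemma nodes_Ioc_subset_I: "{l m<..l n} \<subseteq> I"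
  using nodes_subset_I[of m n] by (meson greaterThanAtMost_subseteq_atLeastAtMost_iff order_refl subset_trans)

lemma Lp_power_le_nodal_power:
  assumes reg: "sobolev_regular r I F"
  shows "Lp_power p I F \<le> ennreal (discretization_const r K powr p) *
    (nodal_power p l F + Lp_power p I (nth_derivative I r F))"
proof -
  obtain n0 :: nat where n0: "\<And>n. n \<ge> n0 \<Longrightarrow> 2 * real r * K \<le> l (int n) - l (- int n)"
    by (rule eventually_long[OF adm K]) blast
  have oI: "open I" using open_covered_interval[OF strict_mono_nodes] I by simp
  show ?thesis
    unfolding Lp_power_eq_SUP[OF continuous_on_sobolev_regular[OF r oI reg]]
  proof (rule SUP_least)
    fix n :: nat
    \<comment> \<open>Short windows are first enlarged until the compact estimate applies.\<close>
    define m where "m = max n n0"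
    have "Lp_power p {l (- int n)<..l (int n)} F \<le> Lp_power p {l (- int m)<..l (int m)} F"
      using incseqD[OF incseq_nodes[OF strict_mono_nodes], of n m] by (intro Lp_power_mono) (auto simp: m_def)
    also have "\<dots> \<le> ennreal (discretization_const r K powr p) *
      (node_sum p l F (l (- int m)) (l (int m)) + Lp_power p {l (- int m)<..l (int m)} (nth_derivative I r F))"
      using n0[of m] by (intro Lp_power_le_compact[OF strict_mono_nodes node_gap K r p I reg nodes_subset_I])
        (simp add: m_def)
    also have "\<dots> \<le> ennreal (discretization_const r K powr p) *
      (nodal_power p l F + Lp_power p I (nth_derivative I r F))"
    proof (intro mult_left_mono add_mono)
      show "node_sum p l F (l (- int m)) (l (int m)) \<le> nodal_power p l F"
        unfolding node_sum_def nodal_power_eq_SUP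
        using finite_nodes[OF strict_mono_nodes, of "l (- int m)" "l (int m)"] nodes_subset_I I
        by (intro SUP_upper) auto
      show "Lp_power p {l (- int m)<..l (int m)} (nth_derivative I r F) \<le> Lp_power p I (nth_derivative I r F)"
        by (intro Lp_power_mono nodes_Ioc_subset_I)
    qed simp
    finally show "Lp_power p {l (- int n)<..l (int n)} F \<le> \<dots>" .
  qed
qed

lemma nodal_power_le_Lp_power:
  assumes reg: "sobolev_regular r I F"
  shows "nodal_power p l F \<le> ennreal (discretization_const r K powr p) *
    (Lp_power p I F + Lp_power p I (nth_derivative I r F))"
proof -
  obtain n0 :: nat where n0: "\<And>n. n \<ge> n0 \<Longrightarrow> 2 * real r * K \<le> l (int n) - l (- int n)"
    by (rule eventually_long[OF adm K]) blast
  show ?thesis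
    unfolding nodal_power_eq_SUP
  proof (rule SUP_least)
    fix A :: "int set" assume "A \<in> {A. finite A}"
    then have A: "finite A" by simp
    \<comment> \<open>The \<open>+ 1\<close> makes \<open>- int n < k\<close> strict for all
      \<open>k\<close> in \<open>A\<close>, since \<open>node_sum\<close> omits the left
      endpoint.\<close>
    define n where "n = max n0 (nat (Max (insert 0 ((\<lambda>k. \<bar>k\<bar>) ` A)) + 1))"
    have "\<bar>k\<bar> < int n" if "k \<in> A" for k
    proof -
      have "\<bar>k\<bar> \<le> Max (insert 0 ((\<lambda>k. \<bar>k\<bar>) ` A))" using A that by (intro Max_ge) auto
      then show ?thesis by (simp add: n_def)
    qed
    then have "- int n < k" "k \<le> int n" if "k \<in> A" for k using that by fastforce+
    then have sub: "A \<subseteq> {k. l (- int n) < l k \<and> l k \<le> l (int n)}"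
      using strict_mono_nodes by (auto simp: strict_mono_less strict_mono_less_eq)
    have "(\<Sum>n\<in>A. ennreal ((l (n + 1) - l (n - 1)) * cmod (F (l n)) powr p)) \<le> node_sum p l F (l (- int n)) (l (int n))"
      unfolding node_sum_def
      using finite_nodes[OF strict_mono_nodes, of "l (- int n)" "l (int n)"] nodes_subset_I I sub
      by (intro sum_mono2) auto
    also have "\<dots> \<le> ennreal (discretization_const r K powr p) *
      (Lp_power p {l (- int n)<..l (int n)} F + Lp_power p {l (- int n)<..l (int n)} (nth_derivative I r F))"
      using n0[of n] by (intro node_sum_le_compact[OF strict_mono_nodes node_gap K r p I reg nodes_subset_I])
        (simp add: n_def)
    also have "\<dots> \<le> ennreal (discretization_const r K powr p) *
      (Lp_power p I F + Lp_power p I (nth_derivative I r F))"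
      by (intro mult_left_mono add_mono Lp_power_mono nodes_Ioc_subset_I) simp
    finally show "(\<Sum>n\<in>A. ennreal ((l (n + 1) - l (n - 1)) * cmod (F (l n)) powr p)) \<le> \<dots>" .
  qed
qed

lemma L_norm_le_W_norm: "L_norm p r I F \<le> W_norm p r I F"
  unfolding L_norm_def W_norm_def using p by (intro ennreal_root_mono) auto

lemma W_space_subset_L_space: "W_space p r I \<subseteq> L_space p r I"
  using L_norm_le_W_norm by (auto simp: W_space_def L_space_def intro: le_less_trans)

lemma nodal_root_le_W_norm:
  assumes "F \<in> W_space p r I"
  shows "ennreal_root p (nodal_power p l F) \<le> ennreal (discretization_const r K) * W_norm p r I F"
proof -
  have "sobolev_regular r I F" using assms by (simp add: W_space_def)
  from ennreal_root_mono[OF nodal_power_le_Lp_power[OF this], of p]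
  show ?thesis unfolding W_norm_def using discretization_const_pos[OF r K] p
    by (simp add: ennreal_root_powr_mult)
qed

text \<open>\<open>F\<close> is only assumed to lie in \<open>L_space\<close>, so this also proves
  membership in \<open>W_space\<close> once the nodal sum is finite. One factor 2 comes from
  bounding both terms of the norm by the same quantity, the other from splitting the root of a
  sum.\<close>

lemma W_norm_le_nodal_root:
  assumes F: "F \<in> L_space p r I"
  shows "W_norm p r I F \<le> ennreal (4 * max 1 (discretization_const r K)) *
    (ennreal_root p (nodal_power p l F) + L_norm p r I F)"
proof -
  define E where "E = max 1 (discretization_const r K)"
  define \<nu> where "\<nu> = Lp_power p I (nth_derivative I r F)"
  define N where "N = nodal_power p l F"
  have E: "E \<ge> 1" "discretization_const r K \<le> E" by (auto simp: E_def)
  have reg: "sobolev_regular r I F" using F by (simp add: L_space_def)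
  have "Lp_power p I F \<le> ennreal (E powr p) * (N + \<nu>)"
    using Lp_power_le_nodal_power[OF reg] unfolding \<nu>_def N_def
    by (rule order_trans) (use E p discretization_const_pos[OF r K] in
      \<open>auto intro!: mult_right_mono ennreal_leI powr_mono2\<close>)
  moreover have "\<nu> \<le> ennreal (E powr p) * (N + \<nu>)"
  proof -
    have "1 powr p \<le> E powr p" using E p by (intro powr_mono2) auto
    then have "1 * (N + \<nu>) \<le> ennreal (E powr p) * (N + \<nu>)"
      by (intro mult_right_mono) auto
    then show ?thesis by (simp add: le_add2 order_trans[rotated])
  qed
  ultimately have "W_norm p r I F \<le> ennreal_root p (ennreal (E powr p) * (N + \<nu>) + ennreal (E powr p) * (N + \<nu>))"
    unfolding W_norm_def \<nu>_def using p by (intro ennreal_root_mono add_mono) auto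
  also have "\<dots> \<le> ennreal_root p (ennreal ((2 * E) powr p) * (N + \<nu>))"
  proof (intro ennreal_root_mono)
    have "(2::real) powr 1 \<le> 2 powr p" using p by (intro powr_mono) auto
    then have "2 * E powr p \<le> (2 * E) powr p" by (simp add: powr_mult mult_right_mono)
    then have "ennreal (E powr p + E powr p) * (N + \<nu>) \<le> ennreal ((2 * E) powr p) * (N + \<nu>)"
      by (intro mult_right_mono ennreal_leI) auto
    then show "ennreal (E powr p) * (N + \<nu>) + ennreal (E powr p) * (N + \<nu>) \<le> ennreal ((2 * E) powr p) * (N + \<nu>)"
      by (simp only: ennreal_plus powr_ge_zero distrib_right)
  qed (use p in simp)
  also have "\<dots> = ennreal (2 * E) * ennreal_root p (N + \<nu>)"
    using E p by (intro ennreal_root_powr_mult) auto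
  also have "\<dots> \<le> ennreal (2 * E) * (ennreal 2 * (ennreal_root p N + ennreal_root p \<nu>))"
    using ennreal_root_add_le[OF p] by (intro mult_left_mono) auto
  also have "\<dots> = ennreal (4 * E) * (ennreal_root p N + ennreal_root p \<nu>)"
  proof -
    have "ennreal (2 * E) * ennreal 2 = ennreal (4 * E)" using E by (subst ennreal_mult[symmetric]) auto
    then show ?thesis by (metis mult.assoc)
  qed
  finally show ?thesis by (simp add: E_def N_def \<nu>_def L_norm_def)
qed

end

lemma le_mult_INF:
  fixes X :: ennreal
  assumes "c > 0" "\<And>F. F \<in> S \<Longrightarrow> X \<le> ennreal c * N F"
  shows "X \<le> ennreal c * (INF F\<in>S. N F)"
proof -
  have "ennreal (1 / c) * X \<le> (INF F\<in>S. N F)"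
  proof (rule INF_greatest)
    fix F assume "F \<in> S"
    then have "ennreal (1 / c) * X \<le> ennreal (1 / c) * (ennreal c * N F)"
      using assms by (intro mult_left_mono) auto
    then show "ennreal (1 / c) * X \<le> N F" using assms(1) by (simp flip: mult.assoc ennreal_mult)
  qed
  then have "ennreal c * (ennreal (1 / c) * X) \<le> ennreal c * (INF F\<in>S. N F)"
    by (rule mult_left_mono) simp
  then show ?thesis using assms(1) by (simp flip: mult.assoc ennreal_mult)
qed

text \<open>A near-minimizer within \<open>e / c\<close> loses at most \<open>e\<close>; it exists
  because the infimum may be taken finite, the bound being trivial otherwise.\<close>

lemma le_mult_add_INF:
  fixes X a :: ennreal
  assumes c: "c > 0" and X: "\<And>F. F \<in> S \<Longrightarrow> X \<le> ennreal c * (a + N F)"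
  shows "X \<le> ennreal c * (a + (INF F\<in>S. N F))"
proof (rule ennreal_le_epsilon)
  define i where "i = (INF F\<in>S. N F)"
  fix e :: real assume e: "0 < e" and fin: "ennreal c * (a + (INF F\<in>S. N F)) < top"
  have "i \<noteq> top"
    using fin c unfolding i_def[symmetric] by (auto simp: ennreal_mult_top)
  then have "i < i + ennreal (e / c)"
    using e c by (cases i) (auto simp: ennreal_less_iff simp flip: ennreal_plus)
  then obtain F where F: "F \<in> S" "N F < i + ennreal (e / c)"
    unfolding i_def INF_less_iff by blast
  have "X \<le> ennreal c * (a + (i + ennreal (e / c)))"
    using X[OF F(1)] F(2) by (meson add_left_mono less_imp_le mult_left_mono order_trans zero_le)
  also have "\<dots> = ennreal c * (a + i) + ennreal e"
    using c e by (simp add: distrib_left add.assoc flip: ennreal_mult)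
  finally show "X \<le> ennreal c * (a + (INF F\<in>S. N F)) + ennreal e" by (simp only: i_def)
qed

lemma trace_norm_le:
  assumes "F \<in> X" "restriction F \<Lambda> = f"
  shows "trace_norm X N \<Lambda> f \<le> N F"
  unfolding trace_norm_def using assms by (intro INF_lower) auto

lemma simpW_norm_eq: "simpW_norm p r l f = ennreal_root p (eqL_power p r l f + nodal_power p l f)"
  by (simp add: simpW_norm_def nodal_power_def)

text \<open>Lower bound: for every extension in \<open>W_space\<close>, \<open>A\<close> controls
  the divided differences and discretization the nodal part. Upper bound: every extension of
  \<open>f\<close> in \<open>L_space\<close> is an admissible competitor in \<open>W_space\<close>,
  so the infimum that \<open>B\<close> controls is available.\<close>

lemma trace_norm_equivalence:
  fixes r :: nat and K A B p :: real and l :: "int \<Rightarrow> real"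
  defines "D \<equiv> max 1 (discretization_const r K)"
  assumes r: "r \<ge> 1" and K: "K > 0" and A: "A > 0" and B: "B > 0" and p: "p \<ge> 1"
    and adm: "admissible_sequence r K l" and I: "I = covered_interval l"
    and eq: "\<forall>f\<in>trace_space (L_space p r I) (range l).
      ennreal A * eqL_norm p r l f \<le> trace_norm (L_space p r I) (L_norm p r I) (range l) f \<and>
      trace_norm (L_space p r I) (L_norm p r I) (range l) f \<le> ennreal B * eqL_norm p r l f"
    and f: "f \<in> trace_space (W_space p r I) (range l)"
  shows "ennreal (1 / (2 * (1 / A + D))) * simpW_norm p r l f \<le> trace_norm (W_space p r I) (W_norm p r I) (range l) f"
    and "trace_norm (W_space p r I) (W_norm p r I) (range l) f \<le> ennreal (4 * D * (1 + B)) * simpW_norm p r l f"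
proof -
  note nodal = nodal_root_le_W_norm[OF adm K r p I]
  have D: "D \<ge> 1" "discretization_const r K \<le> D" by (auto simp: D_def)
  have WL: "W_space p r I \<subseteq> L_space p r I" by (rule W_space_subset_L_space[OF adm K r p I])
  then have fL: "f \<in> trace_space (L_space p r I) (range l)" using f by (auto simp: trace_space_def)
  have nodal_f: "ennreal_root p (nodal_power p l f) \<le> ennreal D * W_norm p r I F"
    if "F \<in> W_space p r I" "restriction F (range l) = f" for F
  proof -
    have "ennreal_root p (nodal_power p l f) \<le> ennreal (discretization_const r K) * W_norm p r I F"
      using nodal[OF that(1)] nodal_power_restriction[of p l F] that(2) by simp
    also have "\<dots> \<le> ennreal D * W_norm p r I F" using D by (intro mult_right_mono ennreal_leI) auto
    finally show ?thesis .
  qed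
  define c where "c = 2 * (1 / A + D)"
  have c: "c > 0" using A D by (simp add: c_def add_pos_pos)
  have "simpW_norm p r l f \<le> ennreal c * (INF F\<in>{F \<in> W_space p r I. restriction F (range l) = f}. W_norm p r I F)"
  proof (rule le_mult_INF[OF c])
    fix F assume "F \<in> {F \<in> W_space p r I. restriction F (range l) = f}"
    then have F: "F \<in> W_space p r I" "restriction F (range l) = f" by auto
    have "ennreal A * eqL_norm p r l f \<le> trace_norm (L_space p r I) (L_norm p r I) (range l) f"
      using eq fL by blast
    also have "\<dots> \<le> L_norm p r I F" using F WL by (intro trace_norm_le) auto
    also have "\<dots> \<le> W_norm p r I F" by (rule L_norm_le_W_norm[OF adm K r p I])
    finally have "ennreal (1 / A) * (ennreal A * eqL_norm p r l f) \<le> ennreal (1 / A) * W_norm p r I F"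
      by (intro mult_left_mono) auto
    then have "eqL_norm p r l f \<le> ennreal (1 / A) * W_norm p r I F"
      using A by (simp flip: mult.assoc ennreal_mult)
    then have "ennreal 2 * (eqL_norm p r l f + ennreal_root p (nodal_power p l f))
        \<le> ennreal 2 * (ennreal (1 / A) * W_norm p r I F + ennreal D * W_norm p r I F)"
      using nodal_f[OF F] by (intro mult_left_mono add_mono) auto
    also have "\<dots> = ennreal c * W_norm p r I F"
    proof -
      have "ennreal c = ennreal 2 * (ennreal (1 / A) + ennreal D)"
        using A D unfolding c_def by (subst ennreal_mult) auto
      then show ?thesis by (simp only: distrib_right mult.assoc)
    qed
    finally show "simpW_norm p r l f \<le> ennreal c * W_norm p r I F"
      using ennreal_root_add_le[OF p, of "eqL_power p r l f" "nodal_power p l f"]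
      unfolding simpW_norm_eq eqL_norm_def by (rule order_trans[rotated])
  qed
  then have "ennreal (1 / c) * simpW_norm p r l f \<le> ennreal (1 / c) * (ennreal c * trace_norm (W_space p r I) (W_norm p r I) (range l) f)"
    unfolding trace_norm_def by (intro mult_left_mono) auto
  then show "ennreal (1 / (2 * (1 / A + D))) * simpW_norm p r l f \<le> trace_norm (W_space p r I) (W_norm p r I) (range l) f"
    using c unfolding c_def[symmetric] by (simp flip: mult.assoc ennreal_mult)
  have nodal_fin: "ennreal_root p (nodal_power p l f) < \<infinity>"
  proof -
    obtain F where F: "F \<in> W_space p r I" "restriction F (range l) = f" using f by (auto simp: trace_space_def)
    have "ennreal D * W_norm p r I F < \<infinity>" using F by (simp add: W_space_def ennreal_mult_less_top)
    then show ?thesis using nodal_f[OF F] by (rule le_less_trans[rotated])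
  qed
  \<comment> \<open>The infimum on the right ranges over extensions in \<open>L_space\<close>. They
    belong to \<open>W_space\<close> because \<open>nodal_fin\<close>, obtained from one extension
    in \<open>W_space\<close>, holds for the common trace.\<close>
  have "trace_norm (W_space p r I) (W_norm p r I) (range l) f
      \<le> ennreal (4 * D) * (ennreal_root p (nodal_power p l f) + (INF F\<in>{F \<in> L_space p r I. restriction F (range l) = f}. L_norm p r I F))"
  proof (rule le_mult_add_INF)
    fix F assume "F \<in> {F \<in> L_space p r I. restriction F (range l) = f}"
    then have F: "F \<in> L_space p r I" "restriction F (range l) = f" by auto
    have nF: "nodal_power p l F = nodal_power p l f" using nodal_power_restriction[of p l F] F(2) by simp
    have le: "W_norm p r I F \<le> ennreal (4 * D) * (ennreal_root p (nodal_power p l f) + L_norm p r I F)"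
      using W_norm_le_nodal_root[OF adm K r p I F(1)] by (simp add: nF D_def)
    also have "\<dots> < \<infinity>" using nodal_fin F(1) by (simp add: L_space_def ennreal_mult_less_top)
    finally have "F \<in> W_space p r I" using F(1) by (simp add: W_space_def L_space_def)
    then show "trace_norm (W_space p r I) (W_norm p r I) (range l) f
      \<le> ennreal (4 * D) * (ennreal_root p (nodal_power p l f) + L_norm p r I F)"
      using trace_norm_le[OF _ F(2)] le by (meson order_trans)
  qed (use D in simp)
  also have "\<dots> \<le> ennreal (4 * D) * (simpW_norm p r l f + ennreal B * simpW_norm p r l f)"
  proof (intro mult_left_mono add_mono)
    show "ennreal_root p (nodal_power p l f) \<le> simpW_norm p r l f"
      unfolding simpW_norm_eq using p by (intro ennreal_root_mono) auto
    have "(INF F\<in>{F \<in> L_space p r I. restriction F (range l) = f}. L_norm p r I F) \<le> ennreal B * eqL_norm p r l f"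
      using eq fL unfolding trace_norm_def by blast
    also have "\<dots> \<le> ennreal B * simpW_norm p r l f"
      unfolding simpW_norm_eq eqL_norm_def using p by (intro mult_left_mono ennreal_root_mono) auto
    finally show "(INF F\<in>{F \<in> L_space p r I. restriction F (range l) = f}. L_norm p r I F) \<le> ennreal B * simpW_norm p r l f" .
  qed simp
  also have "\<dots> = ennreal (4 * D * (1 + B)) * simpW_norm p r l f"
  proof -
    have "ennreal (4 * D * (1 + B)) = ennreal (4 * D) * (1 + ennreal B)"
      using D B by (simp add: ennreal_mult)
    then show ?thesis by (simp only: distrib_left distrib_right mult.assoc mult_1)
  qed
  finally show "trace_norm (W_space p r I) (W_norm p r I) (range l) f \<le> ennreal (4 * D * (1 + B)) * simpW_norm p r l f" .
qed

text \<open>\<open>T f\<close> has the same nodal part as any extension \<open>F\<close> of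
  \<open>f\<close>, and its top derivative is controlled by that of \<open>F\<close> through the
  bound for \<open>T\<close>. Linearity and interpolation are inherited on the smaller trace
  space.\<close>

lemma quasi_optimal_interpolator_L_imp_W:
  fixes r :: nat and K p :: real and l :: "int \<Rightarrow> real"
  assumes r: "r \<ge> 1" and K: "K > 0" and p: "p \<ge> 1"
    and adm: "admissible_sequence r K l" and I: "I = covered_interval l"
    and T: "quasi_optimal_interpolator (L_space p r I) (L_norm p r I) (range l) T"
  shows "quasi_optimal_interpolator (W_space p r I) (W_norm p r I) (range l) T"
proof -
  define D where "D = max 1 (discretization_const r K)"
  have D: "D \<ge> 1" "discretization_const r K \<le> D" by (auto simp: D_def)
  have WL: "W_space p r I \<subseteq> L_space p r I" by (rule W_space_subset_L_space[OF adm K r p I])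
  have tr: "f \<in> trace_space (L_space p r I) (range l)" if "f \<in> trace_space (W_space p r I) (range l)" for f
    using WL that by (auto simp: trace_space_def)
  obtain M where M: "\<And>f. f \<in> trace_space (L_space p r I) (range l) \<Longrightarrow>
      L_norm p r I (T f) \<le> ennreal M * trace_norm (L_space p r I) (L_norm p r I) (range l) f"
    using T unfolding quasi_optimal_interpolator_def by blast
  \<comment> \<open>\<open>D\<close> pays for the nodal part and \<open>max M 0\<close> for the
    derivative; \<open>M\<close> is an arbitrary real, possibly negative.\<close>
  define c where "c = 4 * D * (D + max M 0)"
  have c: "c > 0" using D by (simp add: c_def add_pos_nonneg)
  have bound: "W_norm p r I (T f) \<le> ennreal c * W_norm p r I F"
    if F: "F \<in> W_space p r I" "restriction F (range l) = f" for f F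
  proof -
    have f: "f \<in> trace_space (L_space p r I) (range l)"
      using tr F by (auto simp: trace_space_def)
    have TL: "T f \<in> L_space p r I" "restriction (T f) (range l) = f"
      using T f by (auto simp: quasi_optimal_interpolator_def)
    have "nodal_power p l (T f) = nodal_power p l F"
      using nodal_power_restriction[of p l F] nodal_power_restriction[of p l "T f"] F(2) TL(2) by simp
    then have "W_norm p r I (T f) \<le> ennreal (4 * D) * (ennreal_root p (nodal_power p l F) + L_norm p r I (T f))"
      using W_norm_le_nodal_root[OF adm K r p I TL(1)] by (simp add: D_def)
    also have "\<dots> \<le> ennreal (4 * D) * (ennreal D * W_norm p r I F + ennreal (max M 0) * W_norm p r I F)"
    proof (intro mult_left_mono add_mono)
      show "ennreal_root p (nodal_power p l F) \<le> ennreal D * W_norm p r I F"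
        by (rule order_trans[OF nodal_root_le_W_norm[OF adm K r p I F(1)]])
          (use D in \<open>auto intro!: mult_right_mono ennreal_leI\<close>)
      have "L_norm p r I (T f) \<le> ennreal M * trace_norm (L_space p r I) (L_norm p r I) (range l) f"
        by (rule M[OF f])
      also have "\<dots> \<le> ennreal (max M 0) * L_norm p r I F"
        using F WL by (intro mult_mono trace_norm_le ennreal_leI) auto
      also have "\<dots> \<le> ennreal (max M 0) * W_norm p r I F"
        by (intro mult_left_mono L_norm_le_W_norm[OF adm K r p I]) simp
      finally show "L_norm p r I (T f) \<le> ennreal (max M 0) * W_norm p r I F" .
    qed simp
    also have "\<dots> = ennreal c * W_norm p r I F"
    proof -
      have "ennreal c = ennreal (4 * D) * (ennreal D + ennreal (max M 0))"
        using D unfolding c_def by (subst ennreal_mult) auto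
      then show ?thesis by (simp only: distrib_right mult.assoc)
    qed
    finally show ?thesis .
  qed
  have mem: "T f \<in> W_space p r I" if f: "f \<in> trace_space (W_space p r I) (range l)" for f
  proof -
    obtain F where F: "F \<in> W_space p r I" "restriction F (range l) = f" using f by (auto simp: trace_space_def)
    have "ennreal c * W_norm p r I F < \<infinity>" using F by (simp add: W_space_def ennreal_mult_less_top)
    then have "W_norm p r I (T f) < \<infinity>" using bound[OF F] by (rule le_less_trans[rotated])
    moreover have "T f \<in> L_space p r I" using T tr[OF f] by (auto simp: quasi_optimal_interpolator_def)
    ultimately show ?thesis by (simp add: W_space_def L_space_def)
  qed
  have "W_norm p r I (T f) \<le> ennreal c * trace_norm (W_space p r I) (W_norm p r I) (range l) f" for f
    unfolding trace_norm_def using bound by (intro le_mult_INF[OF c]) auto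
  then have "\<exists>M::real. \<forall>f\<in>trace_space (W_space p r I) (range l).
      W_norm p r I (T f) \<le> ennreal M * trace_norm (W_space p r I) (W_norm p r I) (range l) f" by blast
  then show ?thesis
    using T tr mem unfolding quasi_optimal_interpolator_def by simp
qed

theorem proposition7:
  fixes r :: nat and K :: real
  assumes "r \<ge> 1" and "K > 0"
  shows
    "(\<forall>A B :: real. A > 0 \<and> B > 0 \<longrightarrow>
       (\<exists>C C' :: real. C > 0 \<and> C' > 0 \<and>
         (\<forall>(p :: real) (l :: int \<Rightarrow> real).
            let \<Lambda> = range l; I = covered_interval l; L = L_space p r I; W = W_space p r I in
            p \<ge> 1 \<and> admissible_sequence r K l \<and>
            (\<forall>f\<in>trace_space L \<Lambda>.
               ennreal A * eqL_norm p r l f \<le> trace_norm L (L_norm p r I) \<Lambda> f \<and>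
               trace_norm L (L_norm p r I) \<Lambda> f \<le> ennreal B * eqL_norm p r l f)
            \<longrightarrow>
            (\<forall>f\<in>trace_space W \<Lambda>.
               ennreal C * simpW_norm p r l f \<le> trace_norm W (W_norm p r I) \<Lambda> f \<and>
               trace_norm W (W_norm p r I) \<Lambda> f \<le> ennreal C' * simpW_norm p r l f))))
     \<and>
     (\<forall>(p :: real) (l :: int \<Rightarrow> real) T.
        let \<Lambda> = range l; I = covered_interval l; L = L_space p r I; W = W_space p r I in
        p \<ge> 1 \<and> admissible_sequence r K l \<and>
        quasi_optimal_interpolator L (L_norm p r I) \<Lambda> T \<longrightarrow>
        quasi_optimal_interpolator W (W_norm p r I) \<Lambda> T)"
proof (rule conjI)
  define D where "D = max 1 (discretization_const r K)"
  have D: "D \<ge> 1" by (simp add: D_def)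
  show "\<forall>A B :: real. A > 0 \<and> B > 0 \<longrightarrow>
       (\<exists>C C' :: real. C > 0 \<and> C' > 0 \<and>
         (\<forall>(p :: real) (l :: int \<Rightarrow> real).
            let \<Lambda> = range l; I = covered_interval l; L = L_space p r I; W = W_space p r I in
            p \<ge> 1 \<and> admissible_sequence r K l \<and>
            (\<forall>f\<in>trace_space L \<Lambda>.
               ennreal A * eqL_norm p r l f \<le> trace_norm L (L_norm p r I) \<Lambda> f \<and>
               trace_norm L (L_norm p r I) \<Lambda> f \<le> ennreal B * eqL_norm p r l f)
            \<longrightarrow>
            (\<forall>f\<in>trace_space W \<Lambda>.
               ennreal C * simpW_norm p r l f \<le> trace_norm W (W_norm p r I) \<Lambda> f \<and>
               trace_norm W (W_norm p r I) \<Lambda> f \<le> ennreal C' * simpW_norm p r l f)))"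
  proof (intro allI impI)
    fix A B :: real assume AB: "A > 0 \<and> B > 0"
    show "\<exists>C C' :: real. C > 0 \<and> C' > 0 \<and>
         (\<forall>(p :: real) (l :: int \<Rightarrow> real).
            let \<Lambda> = range l; I = covered_interval l; L = L_space p r I; W = W_space p r I in
            p \<ge> 1 \<and> admissible_sequence r K l \<and>
            (\<forall>f\<in>trace_space L \<Lambda>.
               ennreal A * eqL_norm p r l f \<le> trace_norm L (L_norm p r I) \<Lambda> f \<and>
               trace_norm L (L_norm p r I) \<Lambda> f \<le> ennreal B * eqL_norm p r l f)
            \<longrightarrow>
            (\<forall>f\<in>trace_space W \<Lambda>.
               ennreal C * simpW_norm p r l f \<le> trace_norm W (W_norm p r I) \<Lambda> f \<and>
               trace_norm W (W_norm p r I) \<Lambda> f \<le> ennreal C' * simpW_norm p r l f))"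
      unfolding Let_def
    \<comment> \<open>Both witnesses are built from \<open>D\<close>, \<open>A\<close> and
      \<open>B\<close>, with \<open>D\<close> determined by \<open>r\<close> and \<open>K\<close>,
      so they can be fixed before \<open>p\<close> and \<open>l\<close>.\<close>
    proof (rule exI[of _ "1 / (2 * (1 / A + D))"], rule exI[of _ "4 * D * (1 + B)"], intro conjI allI impI ballI)
      show "1 / (2 * (1 / A + D)) > 0" using AB D by (simp add: add_pos_pos)
      show "4 * D * (1 + B) > 0" using AB D by simp
    qed (use AB trace_norm_equivalence[OF assms, of A B, OF _ _ _ _ refl] in \<open>auto simp: D_def\<close>)
  qed
next
  show "\<forall>(p :: real) (l :: int \<Rightarrow> real) T.
        let \<Lambda> = range l; I = covered_interval l; L = L_space p r I; W = W_space p r I in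
        p \<ge> 1 \<and> admissible_sequence r K l \<and>
        quasi_optimal_interpolator L (L_norm p r I) \<Lambda> T \<longrightarrow>
        quasi_optimal_interpolator W (W_norm p r I) \<Lambda> T"
    unfolding Let_def using quasi_optimal_interpolator_L_imp_W[OF assms _ _ refl] by blast
qed

end
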